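(* Suppose $\Omega \subset \mathbb{C}^d$ is a taut Goldilocks domain. If $f:\Omega \rightarrow \Omega$ is a holomorphic map then either: (1) for any $x \in \Omega$ the orbit $\{ f^n(x): n \in \mathbb{N}\}$ is relatively compact in $\Omega$; or (2) there exists $\xi \in \partial \Omega$ such that $\lim_{n \rightarrow \infty} f^n(x) = \xi$ for any $x \in \Omega$, this convergence being uniform on compact subsets of $\Omega$.
   Context: For a bounded domain $\Omega \subset \mathbb{C}^d$: $K_\Omega$ is the Kobayashi distance on $\Omega$; $k_\Omega(x;v)$ ($x\in\Omega$, $v\in\mathbb{C}^d$) is the infinitesimal Kobayashi (Kobayashi--Royden) metric (normalised so that on the unit disc $\Delta\subset\mathbb{C}$ one has $k_\Delta(\zeta;1)=1/(1-|\zeta|^2)$ and $K_\Delta$ is the corresponding Poincaré distance); $\|\cdot\|$ is the Euclidean norm; $\delta_\Omega(x)$ is the Euclidean distance from $x$ to $\partial\Omega$. Define $$M_\Omega(r) := \sup\left\{ \frac{1}{k_{\Omega}(x;v)} : \delta_\Omega(x) \leq r, \|v\|=1\right\}.$$ A bounded domain $\Omega \subset \mathbb{C}^d$ is a Goldilocks domain if (1) for some (hence any) $\epsilon >0$, $\int_0^\epsilon \frac{1}{r} M_\Omega(r)\, dr < \infty$; and (2) for each $x_0 \in \Omega$ there exist constants $C, \alpha > 0$ (depending on $x_0$) such that $K_\Omega(x_0, x) \leq C + \alpha \log \frac{1}{\delta_\Omega(x)}$ for all $x \in \Omega$. $\Omega$ is taut if the family of holomorphic maps $\Delta\to\Omega$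 is normal: every sequence in it has a subsequence that either converges locally uniformly to a holomorphic map $\Delta\to\Omega$ or is compactly divergent in $\Omega$. $f^n$ denotes the $n$-th iterate of $f$. *)

theory Defs
  imports "HOL-Complex_Analysis.Complex_Analysis"
begin

definition bounded_domain :: "(complex^'d) set \<Rightarrow> bool" where
  "bounded_domain \<Omega> \<longleftrightarrow> open \<Omega> \<and> connected \<Omega> \<and> \<Omega> \<noteq> {} \<and> bounded \<Omega>"

text \<open>A map of several complex variables is holomorphic on an open set if its real Frechet
  derivative exists and is complex linear at every point.\<close>

definition holomorphic_map_on :: "(complex^'n \<Rightarrow> complex^'m) \<Rightarrow> (complex^'n) set \<Rightarrow> bool" where
  "holomorphic_map_on f U \<longleftrightarrow>
     (\<forall>x\<in>U. \<exists>D. (f has_derivative D) (at x) \<and> Vector_Spaces.linear (*s) (*s) D)"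

definition holomorphic_disc :: "(complex^'d) set \<Rightarrow> (complex \<Rightarrow> complex^'d) \<Rightarrow> bool" where
  "holomorphic_disc \<Omega> \<phi> \<longleftrightarrow>
     (\<forall>i. (\<lambda>z. \<phi> z $ i) holomorphic_on ball 0 1) \<and> \<phi> ` ball 0 1 \<subseteq> \<Omega>"

definition disc_deriv :: "(complex \<Rightarrow> complex^'d) \<Rightarrow> complex \<Rightarrow> complex^'d" where
  "disc_deriv \<phi> z = (\<chi> i. deriv (\<lambda>w. \<phi> w $ i) z)"

text \<open>For open \<open>\<Omega>\<close> and \<open>x \<in> \<Omega>\<close> the set below is nonempty: it contains affine discs through \<open>x\<close>.\<close>

definition kobayashi_royden :: "(complex^'d) set \<Rightarrow> complex^'d \<Rightarrow> complex^'d \<Rightarrow> real" where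
  "kobayashi_royden \<Omega> x v =
     Inf {cmod c | c. \<exists>\<phi>. holomorphic_disc \<Omega> \<phi> \<and> \<phi> 0 = x \<and> c *s disc_deriv \<phi> 0 = v}"

text \<open>The Poincare distance is normalised as the integrated form of the metric
  \<open>\<bar>d\<zeta>\<bar> / (1 - \<bar>\<zeta>\<bar>\<^sup>2)\<close>, so that its value at \<open>0, r\<close> is \<open>artanh r\<close>.\<close>

definition poincare_dist :: "complex \<Rightarrow> complex \<Rightarrow> real" where
  "poincare_dist z w = artanh (cmod ((z - w) / (1 - cnj w * z)))"

text \<open>The Kobayashi distance is the infimum over finite chains of holomorphic discs joining
  \<open>x\<close> to \<open>y\<close>. On a domain any two points are joined by a chain.\<close>

definition kobayashi_dist :: "(complex^'d) set \<Rightarrow> complex^'d \<Rightarrow> complex^'d \<Rightarrow> real" where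
  "kobayashi_dist \<Omega> x y =
     Inf {\<Sum>i<n. poincare_dist (a i) (b i) | (n::nat) a b. \<exists>p \<phi>. p 0 = x \<and> p n = y \<and>
            (\<forall>i<n. holomorphic_disc \<Omega> (\<phi> i) \<and> a i \<in> ball 0 1 \<and> b i \<in> ball 0 1 \<and>
                   \<phi> i (a i) = p i \<and> \<phi> i (b i) = p (Suc i))}"

definition boundary_dist :: "(complex^'d) set \<Rightarrow> complex^'d \<Rightarrow> real" where
  "boundary_dist \<Omega> x = infdist x (frontier \<Omega>)"

text \<open>The supremum is taken in \<open>[0, \<infinity>]\<close>, where \<open>1 / 0 = \<infinity>\<close>.\<close>

definition goldilocks_M :: "(complex^'d) set \<Rightarrow> real \<Rightarrow> ennreal" where
  "goldilocks_M \<Omega> r =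
     Sup {1 / ennreal (kobayashi_royden \<Omega> x v) | x v.
            x \<in> \<Omega> \<and> boundary_dist \<Omega> x \<le> r \<and> norm v = 1}"

definition goldilocks_domain :: "(complex^'d) set \<Rightarrow> bool" where
  "goldilocks_domain \<Omega> \<longleftrightarrow> bounded_domain \<Omega> \<and>
     (\<exists>\<epsilon>>0. (\<integral>\<^sup>+ r\<in>{0<..<\<epsilon>}. (1 / ennreal r) * goldilocks_M \<Omega> r \<partial>lborel) < \<infinity>) \<and>
     (\<forall>x\<^sub>0\<in>\<Omega>. \<exists>C \<alpha>. C > 0 \<and> \<alpha> > 0 \<and>
        (\<forall>x\<in>\<Omega>. kobayashi_dist \<Omega> x\<^sub>0 x \<le> C + \<alpha> * ln (1 / boundary_dist \<Omega> x)))"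

text \<open>Locally uniform convergence on the unit disc is expressed as uniform convergence on its
  compact subsets.\<close>

definition taut :: "(complex^'d) set \<Rightarrow> bool" where
  "taut \<Omega> \<longleftrightarrow>
     (\<forall>\<phi> :: nat \<Rightarrow> complex \<Rightarrow> complex^'d. (\<forall>n. holomorphic_disc \<Omega> (\<phi> n)) \<longrightarrow>
        (\<exists>s :: nat \<Rightarrow> nat. strict_mono s \<and>
           ((\<exists>\<psi>. holomorphic_disc \<Omega> \<psi> \<and>
               (\<forall>K. compact K \<and> K \<subseteq> ball 0 1 \<longrightarrow>
                  uniform_limit K (\<lambda>n. \<phi> (s n)) \<psi> sequentially)) \<or>
            (\<forall>K L. compact K \<and> K \<subseteq> ball 0 1 \<and> compact L \<and> L \<subseteq> \<Omega> \<longrightarrow>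
               (\<forall>\<^sub>F n in sequentially. \<phi> (s n) ` K \<inter> L = {})))))"

definition relatively_compact_in :: "'a::topological_space set \<Rightarrow> 'a set \<Rightarrow> bool" where
  "relatively_compact_in \<Omega> S \<longleftrightarrow> (\<exists>L. compact L \<and> L \<subseteq> \<Omega> \<and> S \<subseteq> L)"

end

theory Submission
  imports Defs
begin

text \<open>The Kobayashi distance is defined through chains of discs, and a chain of length \<open>L\<close> is a path,
  parametrised by Poincare length, whose Euclidean speed at \<open>z\<close> is at most \<open>M (\<delta> z)\<close>. Both Goldilocks
  conditions then give visibility: nearly minimal paths joining two points at Euclidean distance
  at least \<open>e\<close> pass through a compact set that depends only on \<open>e\<close>.

  A holomorphic self-map is nonexpanding for the Kobayashi distance. If an orbit has a cluster point in
  \<open>\<Omega>\<close>, its visits to a small ball around that point have bounded gaps, so it is relatively compact, and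
  tautness along chains of discs carries this over to every orbit. Otherwise all orbits approach the
  boundary, where \<open>M\<close> tends to \<open>0\<close>, so the iterates merge locally uniformly, and it remains to
  exclude two distinct cluster points \<open>\<xi>\<close> and \<open>\<eta>\<close> of one orbit. By visibility, iterates near \<open>\<xi>\<close> or
  \<open>\<eta>\<close> are far from the starting point in the Kobayashi distance, and record times of this distance
  yield the contradiction.\<close>

section \<open>Holomorphic discs\<close>

text \<open>The growth condition concerns the distance K, the integral condition the infinitesimal
  metric k. Single discs connect the two: a disc run through at unit Poincare speed has at each time
  the velocity that the disc recentred there has at 0, and the recentred disc itself competes in the
  infimum defining k. The infimum over chains need not be attained, so visibility is proved with an
  error \<kappa>; its compact set is the same for all \<kappa> \<le> 1, which matters because a
  later descent argument needs \<kappa> small. The main obstacle is that \<Omega> is not known to be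
  complete for K: an orbit approaching the boundary might a priori stay at bounded Kobayashi
  distance from its start, and then record times of this distance would say nothing. That bounded
  behaviour is excluded only near one of two distinct cluster points, with the help of the
  other.\<close>

lemma norm_vector_smult: "norm (c *s (x::complex^'d)) = cmod c * norm x"
  by (simp add: norm_vec_def L2_set_def norm_mult power_mult_distrib flip: sum_distrib_left)
     (simp add: real_sqrt_mult)

lemma has_derivative_vec:
  fixes f :: "'a::real_normed_vector \<Rightarrow> complex^'d"
  assumes "\<And>i. ((\<lambda>x. f x $ i) has_derivative (\<lambda>h. D h $ i)) F"
  shows "(f has_derivative D) F"
proof -
  have ax: "bounded_linear (axis i :: complex \<Rightarrow> complex^'d)" for i
    by (rule linear_conv_bounded_linear[THEN iffD1])
       (auto intro!: linearI simp: axis_def vec_eq_iff)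
  have eq: "(\<Sum>i\<in>UNIV. axis i (v $ i)) = v" for v :: "complex^'d"
    by (simp add: vec_eq_iff axis_def sum_component if_distrib cong: if_cong)
  have "((\<lambda>x. \<Sum>i\<in>UNIV. axis i (f x $ i)) has_derivative (\<lambda>h. \<Sum>i\<in>UNIV. axis i (D h $ i))) F"
    by (intro has_derivative_sum bounded_linear.has_derivative[OF ax] assms)
  then show ?thesis by (simp only: eq)
qed

lemma holomorphic_discD:
  assumes "holomorphic_disc \<Omega> \<phi>" "z \<in> ball 0 1"
  shows "\<phi> z \<in> \<Omega>"
  using assms by (auto simp: holomorphic_disc_def)

lemma holomorphic_disc_has_field_derivative:
  assumes "holomorphic_disc \<Omega> \<phi>" "z \<in> ball 0 1"
  shows "((\<lambda>w. \<phi> w $ i) has_field_derivative disc_deriv \<phi> z $ i) (at z)"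
  using assms by (auto simp: holomorphic_disc_def disc_deriv_def intro!: holomorphic_derivI[of _ "ball 0 1"])

lemma holomorphic_disc_has_derivative:
  assumes "holomorphic_disc \<Omega> \<phi>" "z \<in> ball 0 1"
  shows "(\<phi> has_derivative (\<lambda>h. h *s disc_deriv \<phi> z)) (at z)"
proof (rule has_derivative_vec)
  fix i
  show "((\<lambda>x. \<phi> x $ i) has_derivative (\<lambda>h. (h *s disc_deriv \<phi> z) $ i)) (at z)"
    using holomorphic_disc_has_field_derivative[OF assms, of i]
    by (simp add: has_field_derivative_def mult_commute_abs)
qed

lemma holomorphic_disc_compose:
  assumes "holomorphic_disc \<Omega> \<phi>" "g holomorphic_on ball 0 1" "g ` ball 0 1 \<subseteq> ball 0 1"
  shows "holomorphic_disc \<Omega> (\<phi> \<circ> g)"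
  unfolding holomorphic_disc_def
proof (intro conjI allI)
  fix i
  have "(\<lambda>z. \<phi> z $ i) holomorphic_on ball 0 1"
    using assms(1) by (auto simp: holomorphic_disc_def)
  from holomorphic_on_compose_gen[OF assms(2) this assms(3)]
  show "(\<lambda>z. (\<phi> \<circ> g) z $ i) holomorphic_on ball 0 1" by (simp add: o_def)
qed (use assms in \<open>auto simp: holomorphic_disc_def\<close>)

lemma disc_deriv_compose:
  assumes "holomorphic_disc \<Omega> \<phi>" "(g has_field_derivative g') (at z)" "g z \<in> ball 0 1"
  shows "disc_deriv (\<phi> \<circ> g) z = g' *s disc_deriv \<phi> (g z)"
proof (simp only: vec_eq_iff, rule allI)
  fix i
  have "((\<lambda>w. \<phi> w $ i) has_field_derivative disc_deriv \<phi> (g z) $ i) (at (g z))"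
    using assms by (intro holomorphic_disc_has_field_derivative)
  from DERIV_chain2[OF this assms(2)]
  show "disc_deriv (\<phi> \<circ> g) z $ i = (g' *s disc_deriv \<phi> (g z)) $ i"
    by (simp add: disc_deriv_def DERIV_imp_deriv mult.commute)
qed

lemma holomorphic_disc_map:
  assumes "holomorphic_disc \<Omega> \<phi>" "holomorphic_map_on f \<Omega>" "f ` \<Omega> \<subseteq> \<Omega>'"
  shows "holomorphic_disc \<Omega>' (f \<circ> \<phi>)"
  unfolding holomorphic_disc_def
proof (intro conjI allI)
  fix i
  show "(\<lambda>z. (f \<circ> \<phi>) z $ i) holomorphic_on ball 0 1"
  proof (rule holomorphic_onI)
    fix z :: complex assume z: "z \<in> ball 0 1"
    then have "\<phi> z \<in> \<Omega>" using assms(1) holomorphic_discD by blast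
    then obtain D where D: "(f has_derivative D) (at (\<phi> z))" and lin: "Vector_Spaces.linear (*s) (*s) D"
      using assms(2) by (auto simp: holomorphic_map_on_def)
    have "((f \<circ> \<phi>) has_derivative (\<lambda>h. D (h *s disc_deriv \<phi> z))) (at z)"
      using diff_chain_at[OF holomorphic_disc_has_derivative[OF assms(1) z] D] by (simp add: o_def)
    \<comment> \<open>Here the complex linearity of \<open>D\<close> enters: it turns the real
      derivative of each coordinate into multiplication by a complex number.\<close>
    moreover have "D (h *s disc_deriv \<phi> z) = h *s D (disc_deriv \<phi> z)" for h
      using lin by (simp add: Vector_Spaces.linear_iff)
    ultimately have "((f \<circ> \<phi>) has_derivative (\<lambda>h. h *s D (disc_deriv \<phi> z))) (at z)" by simp
    from bounded_linear.has_derivative[OF bounded_linear_vec_nth this, of i]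
    have "((\<lambda>z. (f \<circ> \<phi>) z $ i) has_field_derivative D (disc_deriv \<phi> z) $ i) (at z)"
      by (simp add: has_field_derivative_def mult_commute_abs)
    then show "(\<lambda>z. (f \<circ> \<phi>) z $ i) field_differentiable at z within ball 0 1"
      by (auto simp: field_differentiable_def intro: has_field_derivative_at_within)
  qed
qed (use assms in \<open>force simp: holomorphic_disc_def\<close>)

lemma holomorphic_disc_affine:
  assumes "\<And>z. cmod z < 1 \<Longrightarrow> x + z *s v \<in> \<Omega>"
  shows "holomorphic_disc \<Omega> (\<lambda>z. x + z *s v)" "disc_deriv (\<lambda>z. x + z *s v) z = v"
proof -
  have "((\<lambda>z. (x + z *s v) $ i) has_field_derivative v $ i) (at z)" for i z
    by (auto intro!: derivative_eq_intros)
  then show "disc_deriv (\<lambda>z. x + z *s v) z = v"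
    by (simp add: disc_deriv_def vec_eq_iff DERIV_imp_deriv)
qed (use assms in \<open>auto simp: holomorphic_disc_def intro!: holomorphic_intros\<close>)

lemma holomorphic_map_on_imp_continuous_on:
  "holomorphic_map_on f \<Omega> \<Longrightarrow> continuous_on \<Omega> f"
  unfolding holomorphic_map_on_def
  by (intro differentiable_imp_continuous_on) (auto simp: differentiable_on_def differentiable_def intro: has_derivative_at_withinI)

section \<open>Poincare distance and automorphisms of the disc\<close>

lemma poincare_dist_commute: "poincare_dist a b = poincare_dist b a"
proof -
  have "cmod (1 - cnj b * a) = cmod (1 - cnj a * b)"
    by (metis complex_cnj_cnj complex_cnj_diff complex_cnj_mult complex_cnj_one complex_mod_cnj mult.commute)
  then show ?thesis
    by (simp add: poincare_dist_def norm_divide norm_minus_commute)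
qed

lemma pseudo_hyperbolic_less_1:
  assumes "cmod a < 1" "cmod b < 1"
  shows "cmod ((a - b) / (1 - cnj b * a)) < 1"
  using Moebius_function_norm_lt_1[OF assms(2,1), of 0] by (simp add: Moebius_function_simple)

lemma tanh_artanh: "tanh (artanh x) = x" if "\<bar>x\<bar> < 1" for x :: real
proof -
  from that have "0 < (1 + x) / (1 - x)" by auto
  then have "exp (2 * artanh x) = (1 + x) / (1 - x)" by (simp add: artanh_def)
  then have e: "exp (- 2 * artanh x) = (1 - x) / (1 + x)" by (simp add: exp_minus)
  show ?thesis unfolding tanh_real_altdef e using that by (simp add: field_simps)
qed

lemma poincare_dist_nonneg:
  assumes "cmod a < 1" "cmod b < 1"
  shows "poincare_dist a b \<ge> 0"
  unfolding poincare_dist_def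
  using pseudo_hyperbolic_less_1[OF assms] by (simp add: artanh_def)

text \<open>On the real diameter \<open>tanh\<close> is the unit-speed parametrisation of the
  Poincare geodesic: the pseudo-hyperbolic quotient is the subtraction formula for
  \<open>tanh\<close>.\<close>

lemma poincare_dist_tanh:
  assumes "s \<le> t"
  shows "poincare_dist (of_real (tanh s)) (of_real (tanh t)) = t - s"
proof -
  have t: "tanh (t - s) = (tanh t - tanh s) / (1 - tanh t * tanh s)"
    using tanh_add[of t "-s"] by simp
  have "cmod ((of_real (tanh t) - of_real (tanh s)) / (1 - cnj (of_real (tanh s)) * of_real (tanh t)))
      = cmod (of_real (tanh (t - s)))"
    unfolding t by (simp add: mult.commute)
  also have "\<dots> = tanh (t - s)" using assms by simp
  finally have "poincare_dist (of_real (tanh t)) (of_real (tanh s)) = t - s"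
    by (simp only: poincare_dist_def artanh_tanh_real)
  then show ?thesis by (simp add: poincare_dist_commute)
qed

text \<open>An automorphism of the disc takes \<open>a\<close> to 0 and \<open>b\<close> to the
  nonnegative real axis, so every link of a chain can be run through as
  \<open>\<psi> (tanh t)\<close> from time 0 to its Poincare length.\<close>

lemma disc_recentre:
  assumes \<phi>: "holomorphic_disc \<Omega> \<phi>" and a: "a \<in> ball 0 1" and b: "b \<in> ball 0 1"
  obtains \<psi> where "holomorphic_disc \<Omega> \<psi>" "\<psi> 0 = \<phi> a" "\<psi> (of_real (tanh (poincare_dist a b))) = \<phi> b"
proof -
  define w where "w = (b - a) / (1 - cnj a * b)"
  \<comment> \<open>The direction of \<open>w\<close>; for \<open>w = 0\<close> any unimodular
    number would do.\<close>
  define u where "u = (if w = 0 then 1 else w / cmod w)"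
  have u: "cmod u = 1" by (simp add: u_def norm_divide)
  have wu: "u * of_real (cmod w) = w" by (simp add: u_def)
  have w1: "cmod w < 1" using pseudo_hyperbolic_less_1[of b a] a b by (simp add: w_def)
  have T: "tanh (poincare_dist a b) = cmod w"
    using w1 by (subst poincare_dist_commute) (simp add: poincare_dist_def w_def tanh_artanh)
  have na: "norm (-a) < 1" using a by simp
  define g where "g = Moebius_function 0 (-a) \<circ> (\<lambda>z. u * z)"
  have gi: "(\<lambda>z. u * z) ` ball 0 1 \<subseteq> ball 0 1" by (auto simp: norm_mult u)
  have "g holomorphic_on ball 0 1"
    unfolding g_def
    by (rule holomorphic_on_compose_gen[OF _ Moebius_function_holomorphic[OF na] gi])
       (intro holomorphic_intros)
  moreover have "g ` ball 0 1 \<subseteq> ball 0 1"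
    using gi Moebius_function_norm_lt_1[OF na] by (auto simp: g_def norm_mult u)
  ultimately have "holomorphic_disc \<Omega> (\<phi> \<circ> g)" by (rule holomorphic_disc_compose[OF \<phi>])
  moreover have "g 0 = a" by (simp add: g_def Moebius_function_of_zero)
  moreover have "g (of_real (tanh (poincare_dist a b))) = b"
  proof -
    have "Moebius_function 0 (-a) (Moebius_function 0 a b) = b"
      using a b by (intro Moebius_function_compose) auto
    then show ?thesis by (simp add: g_def T wu) (simp add: Moebius_function_simple w_def)
  qed
  ultimately show ?thesis by (intro that[of "\<phi> \<circ> g"]) auto
qed

text \<open>Moving the base point of the disc to \<open>\<tau>\<close> multiplies the derivative by \<open>1 - \<tau>\<^sup>2\<close>, which is
  also the derivative of \<open>tanh\<close> at the parameter of \<open>\<tau>\<close>.\<close>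

lemma disc_translate:
  assumes \<phi>: "holomorphic_disc \<Omega> \<phi>" and t: "\<bar>\<tau>\<bar> < 1"
  obtains \<psi> where "holomorphic_disc \<Omega> \<psi>" "\<psi> 0 = \<phi> (of_real \<tau>)"
    "disc_deriv \<psi> 0 = of_real (1 - \<tau>\<^sup>2) *s disc_deriv \<phi> (of_real \<tau>)"
proof -
  define g where "g = Moebius_function 0 (- of_real \<tau>)"
  have na: "norm (- of_real \<tau> :: complex) < 1" using t by simp
  have "g holomorphic_on ball 0 1" "g ` ball 0 1 \<subseteq> ball 0 1"
    using Moebius_function_holomorphic[OF na] Moebius_function_norm_lt_1[OF na] by (auto simp: g_def)
  then have d: "holomorphic_disc \<Omega> (\<phi> \<circ> g)" by (rule holomorphic_disc_compose[OF \<phi>])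
  have g0: "g 0 = of_real \<tau>" by (simp add: g_def Moebius_function_of_zero)
  have "g = (\<lambda>z. (z + of_real \<tau>) / (1 + of_real \<tau> * z))"
    by (auto simp: g_def Moebius_function_simple)
  moreover have "((\<lambda>z. (z + of_real \<tau>) / (1 + of_real \<tau> * z)) has_field_derivative of_real (1 - \<tau>\<^sup>2)) (at 0)"
    by (auto intro!: derivative_eq_intros simp: power2_eq_square)
  ultimately have "(g has_field_derivative of_real (1 - \<tau>\<^sup>2)) (at 0)" by simp
  from disc_deriv_compose[OF \<phi> this] g0 t
  have "disc_deriv (\<phi> \<circ> g) 0 = of_real (1 - \<tau>\<^sup>2) *s disc_deriv \<phi> (of_real \<tau>)" by simp
  with d g0 show ?thesis by (intro that[of "\<phi> \<circ> g"]) auto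
qed

section \<open>The Kobayashi distance\<close>

text \<open>An index-free form of the sequences in \<open>kobayashi_dist\<close>, so that
  concatenation, reversal and images of chains are inductions adding one link at a time.\<close>

inductive disc_chain :: "(complex^'d) set \<Rightarrow> complex^'d \<Rightarrow> complex^'d \<Rightarrow> real \<Rightarrow> bool" for \<Omega> where
  refl: "disc_chain \<Omega> x x 0"
| step: "\<lbrakk>disc_chain \<Omega> x y L; holomorphic_disc \<Omega> \<phi>; a \<in> ball 0 1; b \<in> ball 0 1; \<phi> a = y; \<phi> b = z\<rbrakk>
    \<Longrightarrow> disc_chain \<Omega> x z (L + poincare_dist a b)"

lemma disc_chain_if_sequence:
  fixes n :: nat
  assumes "p 0 = x"
    and "\<forall>i<n. holomorphic_disc \<Omega> (\<phi> i) \<and> a i \<in> ball 0 1 \<and> b i \<in> ball 0 1 \<and> \<phi> i (a i) = p i \<and> \<phi> i (b i) = p (Suc i)"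
  shows "disc_chain \<Omega> x (p n) (\<Sum>i<n. poincare_dist (a i) (b i))"
  using assms(2)
proof (induction n)
  case 0
  then show ?case using assms(1) disc_chain.refl by simp
next
  case (Suc n)
  then have "disc_chain \<Omega> x (p n) (\<Sum>i<n. poincare_dist (a i) (b i))" by simp
  from disc_chain.step[OF this, of "\<phi> n" "a n" "b n" "p (Suc n)"] Suc.prems show ?case by simp
qed

lemma sequence_if_disc_chain:
  assumes "disc_chain \<Omega> x y L"
  shows "\<exists>(n::nat) a b p \<phi>. L = (\<Sum>i<n. poincare_dist (a i) (b i)) \<and> p 0 = x \<and> p n = y \<and>
    (\<forall>i<n. holomorphic_disc \<Omega> (\<phi> i) \<and> a i \<in> ball 0 1 \<and> b i \<in> ball 0 1 \<and>
                   \<phi> i (a i) = p i \<and> \<phi> i (b i) = p (Suc i))"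
  using assms
proof induction
  case (refl x)
  show ?case by (rule exI[of _ 0]) auto
next
  case (step x y L \<phi>' a' b' z)
  then obtain n :: nat and a b p \<phi> where
    *: "L = (\<Sum>i<n. poincare_dist (a i) (b i))" "p 0 = x" "p n = y"
      "\<forall>i<n. holomorphic_disc \<Omega> (\<phi> i) \<and> a i \<in> ball 0 1 \<and> b i \<in> ball 0 1 \<and>
                   \<phi> i (a i) = p i \<and> \<phi> i (b i) = p (Suc i)" by blast
  show ?case
    by (rule exI[of _ "Suc n"], rule exI[of _ "a(n := a')"], rule exI[of _ "b(n := b')"],
        rule exI[of _ "p(Suc n := z)"], rule exI[of _ "\<phi>(n := \<phi>')"])
       (use *(2-4) step.hyps(2-6) in \<open>simp add: less_Suc_eq *(1)\<close>)
qed

lemma kobayashi_dist_eq_Inf_disc_chain: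
  "kobayashi_dist \<Omega> x y = Inf {L. disc_chain \<Omega> x y L}"
proof -
  have "{\<Sum>i<n. poincare_dist (a i) (b i) | (n::nat) a b. \<exists>p \<phi>. p 0 = x \<and> p n = y \<and>
            (\<forall>i<n. holomorphic_disc \<Omega> (\<phi> i) \<and> a i \<in> ball 0 1 \<and> b i \<in> ball 0 1 \<and>
                   \<phi> i (a i) = p i \<and> \<phi> i (b i) = p (Suc i))} = {L. disc_chain \<Omega> x y L}"
    (is "?A = ?B")
  proof
    show "?A \<subseteq> ?B"
    proof
      fix L assume "L \<in> ?A"
      then obtain n :: nat and a b p \<phi> where "L = (\<Sum>i<n. poincare_dist (a i) (b i))" "p 0 = x" "p n = y"
        "\<forall>i<n. holomorphic_disc \<Omega> (\<phi> i) \<and> a i \<in> ball 0 1 \<and> b i \<in> ball 0 1 \<and> \<phi> i (a i) = p i \<and> \<phi> i (b i) = p (Suc i)"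
        unfolding mem_Collect_eq by (elim exE conjE)
      then show "L \<in> ?B" using disc_chain_if_sequence[of p x n \<Omega> \<phi> a b] by simp
    qed
    show "?B \<subseteq> ?A"
    proof
      fix L assume "L \<in> ?B"
      then have "disc_chain \<Omega> x y L" by simp
      from sequence_if_disc_chain[OF this] show "L \<in> ?A"
        unfolding mem_Collect_eq by (elim exE conjE) (intro exI conjI, assumption+)
    qed
  qed
  then show ?thesis by (simp add: kobayashi_dist_def)
qed

lemma disc_chain_trans:
  assumes "disc_chain \<Omega> y z L'" "disc_chain \<Omega> x y L"
  shows "disc_chain \<Omega> x z (L + L')"
  using assms
proof induction
  case (step y y' L' \<phi> a b z)
  from disc_chain.step[OF step.IH[OF step.prems] step.hyps(2-6)] show ?case by (simp add: add.assoc)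
qed auto

lemma disc_chain_single:
  assumes "holomorphic_disc \<Omega> \<phi>" "a \<in> ball 0 1" "b \<in> ball 0 1"
  shows "disc_chain \<Omega> (\<phi> a) (\<phi> b) (poincare_dist a b)"
  using disc_chain.step[OF disc_chain.refl assms] by simp

lemma disc_chain_sym:
  assumes "disc_chain \<Omega> x y L"
  shows "disc_chain \<Omega> y x L"
  using assms
proof induction
  case (step x y L \<phi> a b z)
  then have "disc_chain \<Omega> z y (poincare_dist b a)" using disc_chain_single by blast
  from disc_chain_trans[OF step.IH this] show ?case
    by (simp add: poincare_dist_commute[of b] add.commute)
qed (rule disc_chain.refl)

lemma disc_chain_nonneg:
  assumes "disc_chain \<Omega> x y L"
  shows "0 \<le> L"
  using assms by induction (auto intro!: add_nonneg_nonneg poincare_dist_nonneg)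

lemma disc_chain_map:
  assumes "disc_chain \<Omega> x y L" "holomorphic_map_on f \<Omega>" "f ` \<Omega> \<subseteq> \<Omega>'"
  shows "disc_chain \<Omega>' (f x) (f y) L"
  using assms(1)
proof induction
  case (step x y L \<phi> a b z)
  from disc_chain.step[OF step.IH holomorphic_disc_map[OF step.hyps(2) assms(2,3)] step.hyps(3,4)] step.hyps(5,6)
  show ?case by simp
qed (rule disc_chain.refl)

lemma disc_chain_local:
  assumes r: "ball x r \<subseteq> \<Omega>" and y: "norm (y - x) < r * tanh e" and e: "0 < e"
  shows "\<exists>L<e. disc_chain \<Omega> x y L"
proof (cases "y = x")
  case True
  then show ?thesis using e disc_chain.refl by blast
next
  case False
  have "0 < r * tanh e" using y norm_ge_zero[of "y - x"] by linarith
  then have r0: "0 < r" using e by (simp add: zero_less_mult_iff)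
  define b where "b = norm (y - x) / r"
  have b: "b < tanh e" "0 < b" using y False r0 by (auto simp: b_def field_simps)
  then have b1: "b < 1" using tanh_real_lt_1[of e] by linarith
  have inball: "x + w \<in> \<Omega>" if "norm w < r" for w
    using that r by (auto simp: dist_norm)
  \<comment> \<open>The factor \<open>1/b\<close> stretches \<open>y - x\<close> to length
    \<open>r\<close>: the image is a disc of radius \<open>r\<close> about \<open>x\<close> that
    meets \<open>y\<close> at the parameter \<open>b\<close>, at Poincare distance
    \<open>artanh b < e\<close> from 0.\<close>
  define \<phi> where "\<phi> = (\<lambda>z. x + z *s (of_real (1/b) *s (y - x)))"
  have "holomorphic_disc \<Omega> \<phi>"
    unfolding \<phi>_def
  proof (rule holomorphic_disc_affine)
    fix z assume z: "cmod z < 1"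
    have "norm (z *s (of_real (1/b) *s (y - x))) = cmod z * r"
      unfolding norm_vector_smult using False r0 by (simp add: b_def norm_divide)
    also have "\<dots> < r" using z r0 by simp
    finally show "x + z *s (of_real (1/b) *s (y - x)) \<in> \<Omega>"
      by (rule inball)
  qed
  from disc_chain_single[OF this, of 0 "of_real b"] b b1
  have "disc_chain \<Omega> (\<phi> 0) (\<phi> (of_real b)) (poincare_dist 0 (of_real b))" by simp
  moreover have "\<phi> 0 = x" "\<phi> (of_real b) = y"
    using b by (auto simp: \<phi>_def vec_eq_iff)
  moreover have pb: "poincare_dist 0 (of_real b) = artanh b" using b by (simp add: poincare_dist_def)
  moreover have "tanh (artanh b) < tanh e" using b b1 by (simp add: tanh_artanh)
  ultimately show ?thesis by auto
qed

section \<open>The Kobayashi pseudodistance of a bounded domain\<close>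

locale bdd_domain =
  fixes \<Omega> :: "(complex^'d) set"
  assumes bounded_domain: "bounded_domain \<Omega>"
begin

abbreviation d :: "complex^'d \<Rightarrow> complex^'d \<Rightarrow> real" where "d \<equiv> kobayashi_dist \<Omega>"
abbreviation \<delta> :: "complex^'d \<Rightarrow> real" where "\<delta> \<equiv> boundary_dist \<Omega>"

lemma open_domain: "open \<Omega>" and connected_domain: "connected \<Omega>"
  and domain_nonempty: "\<Omega> \<noteq> {}" and bounded_set: "bounded \<Omega>"
  using bounded_domain by (auto simp: bounded_domain_def)

text \<open>Being joined by a chain is an equivalence relation with open classes. The infimum in
  \<open>kobayashi_dist\<close> thereby ranges over a nonempty set, as the estimates with
  \<open>Inf\<close> on the reals require.\<close>

lemma disc_chain_exists:
  assumes "x \<in> \<Omega>" "y \<in> \<Omega>"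
  shows "\<exists>L. disc_chain \<Omega> x y L"
proof (rule connected_equivalence_relation[OF connected_domain assms])
  fix a assume "a \<in> \<Omega>"
  then obtain r where r: "r > 0" "ball a r \<subseteq> \<Omega>"
    using open_domain open_contains_ball by blast
  then have "r * tanh 1 > 0" by simp
  moreover have "\<exists>L. disc_chain \<Omega> a y L" if "y \<in> ball a (r * tanh 1)" for y
    using disc_chain_local[OF r(2), of y 1] that by (auto simp: dist_norm norm_minus_commute)
  ultimately show "\<exists>T. openin (top_of_set \<Omega>) T \<and> a \<in> T \<and> (\<forall>x\<in>T. \<exists>L. disc_chain \<Omega> a x L)"
    using \<open>a \<in> \<Omega>\<close> by (intro exI[of _ "\<Omega> \<inter> ball a (r * tanh 1)"]) (auto intro: openin_open_Int)
qed (use disc_chain_sym disc_chain_trans in blast)+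

lemma bdd_below_disc_chain: "bdd_below {L. disc_chain \<Omega> x y L}"
  using disc_chain_nonneg by (intro bdd_belowI[of _ 0]) auto

lemma kobayashi_dist_le: "disc_chain \<Omega> x y L \<Longrightarrow> d x y \<le> L"
  unfolding kobayashi_dist_eq_Inf_disc_chain
  by (rule cInf_lower[OF _ bdd_below_disc_chain]) simp

lemma kobayashi_dist_chain:
  assumes "x \<in> \<Omega>" "y \<in> \<Omega>" "d x y < e"
  shows "\<exists>L<e. disc_chain \<Omega> x y L"
  using assms disc_chain_exists cInf_lessD[of "{L. disc_chain \<Omega> x y L}" e]
  unfolding kobayashi_dist_eq_Inf_disc_chain by auto

lemma kobayashi_dist_nonneg:
  assumes "x \<in> \<Omega>" "y \<in> \<Omega>"
  shows "0 \<le> d x y"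
  unfolding kobayashi_dist_eq_Inf_disc_chain
  using disc_chain_exists[OF assms] disc_chain_nonneg by (intro cInf_greatest) auto

lemma kobayashi_dist_commute: "d x y = d y x"
proof -
  have "disc_chain \<Omega> x y = disc_chain \<Omega> y x" using disc_chain_sym by blast
  then show ?thesis by (simp add: kobayashi_dist_eq_Inf_disc_chain)
qed

lemma kobayashi_dist_triangle:
  assumes "x \<in> \<Omega>" "y \<in> \<Omega>" "z \<in> \<Omega>"
  shows "d x z \<le> d x y + d y z"
proof (rule field_le_epsilon)
  fix e :: real assume e: "e > 0"
  obtain L where L: "L < d x y + e/2" "disc_chain \<Omega> x y L"
    using kobayashi_dist_chain[OF assms(1,2), of "d x y + e/2"] e by auto
  obtain L' where L': "L' < d y z + e/2" "disc_chain \<Omega> y z L'"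
    using kobayashi_dist_chain[OF assms(2,3), of "d y z + e/2"] e by auto
  show "d x z \<le> d x y + d y z + e"
    using kobayashi_dist_le[OF disc_chain_trans[OF L'(2) L(2)]] L L' by simp
qed

lemma kobayashi_dist_map_le:
  assumes "holomorphic_map_on f \<Omega>" "f ` \<Omega> \<subseteq> \<Omega>" "x \<in> \<Omega>" "y \<in> \<Omega>"
  shows "d (f x) (f y) \<le> d x y"
proof (rule field_le_epsilon)
  fix e :: real assume e: "e > 0"
  obtain L where L: "L < d x y + e" "disc_chain \<Omega> x y L"
    using kobayashi_dist_chain[OF assms(3,4), of "d x y + e"] e by auto
  show "d (f x) (f y) \<le> d x y + e"
    using kobayashi_dist_le[OF disc_chain_map[OF L(2) assms(1,2)]] L by simp
qed

lemma kobayashi_dist_small: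
  assumes "x \<in> \<Omega>" "e > 0"
  obtains r where "r > 0" "ball x r \<subseteq> \<Omega>" "\<And>y. y \<in> ball x r \<Longrightarrow> d x y < e"
proof -
  obtain s where s: "s > 0" "ball x s \<subseteq> \<Omega>"
    using assms open_domain open_contains_ball by blast
  show ?thesis
  proof (rule that[of "s * tanh e"])
    show "s * tanh e > 0" using s assms by simp
    have "s * tanh e \<le> s" using s tanh_real_lt_1[of e] by (simp add: mult_left_le)
    then show "ball x (s * tanh e) \<subseteq> \<Omega>" using s subset_ball by blast
    fix y assume "y \<in> ball x (s * tanh e)"
    then show "d x y < e"
      using disc_chain_local[OF s(2), of y e] assms kobayashi_dist_le
      by (force simp: dist_norm norm_minus_commute)
  qed
qed

section \<open>Derivatives of discs and the function M\<close>

lemma disc_deriv_bounded: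
  obtains R where "R > 0" "\<And>\<phi>. holomorphic_disc \<Omega> \<phi> \<Longrightarrow> norm (disc_deriv \<phi> 0) \<le> R"
proof -
  obtain B where B: "B > 0" "\<And>x. x \<in> \<Omega> \<Longrightarrow> norm x \<le> B"
    using bounded_set bounded_pos by blast
  show ?thesis
  proof (rule that[of "real CARD('d) * (2 * B)"])
    show "real CARD('d) * (2 * B) > 0" using B by simp
    fix \<phi> :: "complex \<Rightarrow> complex^'d" assume \<phi>: "holomorphic_disc \<Omega> \<phi>"
    have "cmod (disc_deriv \<phi> 0 $ i) \<le> 2 * B" for i
    proof -
      have hol: "(\<lambda>z. \<phi> z $ i) holomorphic_on ball 0 1"
        using \<phi> by (auto simp: holomorphic_disc_def)
      \<comment> \<open>Cauchy's estimate on the circle of radius 1/2 produces the factor 2;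
        \<open>CARD('d)\<close> comes from summing the coordinates.\<close>
      have "cmod ((deriv ^^ 1) (\<lambda>z. \<phi> z $ i) 0) \<le> fact 1 * B / (1/2) ^ 1"
      proof (rule Cauchy_inequality)
        show "(\<lambda>z. \<phi> z $ i) holomorphic_on ball 0 (1/2)"
          by (rule holomorphic_on_subset[OF hol]) auto
        show "continuous_on (cball 0 (1/2)) (\<lambda>z. \<phi> z $ i)"
          by (rule holomorphic_on_imp_continuous_on, rule holomorphic_on_subset[OF hol]) auto
        show "cmod (\<phi> z $ i) \<le> B" if "cmod (0 - z) = 1/2" for z
        proof -
          have "\<phi> z \<in> \<Omega>" using holomorphic_discD[OF \<phi>] that by simp
          then show ?thesis using B(2)[of "\<phi> z"] Finite_Cartesian_Product.norm_nth_le[of "\<phi> z" i] by linarith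
        qed
      qed auto
      then show ?thesis by (simp add: disc_deriv_def)
    qed
    then have "(\<Sum>i\<in>UNIV. cmod (disc_deriv \<phi> 0 $ i)) \<le> real CARD('d) * (2 * B)"
      by (intro order.trans[OF sum_bounded_above]) auto
    then show "norm (disc_deriv \<phi> 0) \<le> real CARD('d) * (2 * B)"
      unfolding norm_vec_def using L2_set_le_sum[of UNIV "\<lambda>i. cmod (disc_deriv \<phi> 0 $ i)"] by simp
  qed
qed

lemma kobayashi_royden_ge:
  assumes R: "R > 0" "\<And>\<phi>. holomorphic_disc \<Omega> \<phi> \<Longrightarrow> norm (disc_deriv \<phi> 0) \<le> R"
    and x: "x \<in> \<Omega>" and v: "norm v = 1"
  shows "1 / R \<le> kobayashi_royden \<Omega> x v"
  unfolding kobayashi_royden_def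
proof (rule cInf_greatest)
  obtain r where r: "r > 0" "ball x r \<subseteq> \<Omega>"
    using x open_domain open_contains_ball by blast
  \<comment> \<open>An affine disc shows that the infimum is taken over a nonempty set, as
    \<open>cInf_greatest\<close> requires.\<close>
  define \<phi> where "\<phi> = (\<lambda>z. x + z *s (of_real r *s v))"
  have "x + z *s (of_real r *s v) \<in> \<Omega>" if "cmod z < 1" for z
  proof -
    have "norm (z *s (of_real r *s v)) = cmod z * r"
      unfolding norm_vector_smult using v r(1) by simp
    also have "\<dots> < r" using that r(1) by simp
    finally have "x + z *s (of_real r *s v) \<in> ball x r" by (simp add: dist_norm del: vector_smult_assoc)
    then show ?thesis using r by blast
  qed
  from holomorphic_disc_affine[OF this]
  have "holomorphic_disc \<Omega> \<phi>" "disc_deriv \<phi> 0 = of_real r *s v" by (simp_all add: \<phi>_def)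
  moreover have "\<phi> 0 = x" by (simp add: \<phi>_def)
  moreover have "of_real (1/r) *s (of_real r *s v) = v" using r by (simp add: vec_eq_iff)
  ultimately have "cmod (of_real (1/r)) \<in> {cmod c |c. \<exists>\<phi>. holomorphic_disc \<Omega> \<phi> \<and> \<phi> 0 = x \<and> c *s disc_deriv \<phi> 0 = v}"
    unfolding mem_Collect_eq by (intro exI[of _ "of_real (1/r)"] exI[of _ \<phi>] conjI) simp_all
  then show "{cmod c |c. \<exists>\<phi>. holomorphic_disc \<Omega> \<phi> \<and> \<phi> 0 = x \<and> c *s disc_deriv \<phi> 0 = v} \<noteq> {}"
    by (rule ex_in_conv[THEN iffD1, OF exI])
next
  fix k assume "k \<in> {cmod c |c. \<exists>\<phi>. holomorphic_disc \<Omega> \<phi> \<and> \<phi> 0 = x \<and> c *s disc_deriv \<phi> 0 = v}"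
  then obtain c \<phi> where c: "k = cmod c" "holomorphic_disc \<Omega> \<phi>" "c *s disc_deriv \<phi> 0 = v" by auto
  have "1 = cmod c * norm (disc_deriv \<phi> 0)"
    using norm_vector_smult[of c "disc_deriv \<phi> 0"] v unfolding c(3) by simp
  also have "\<dots> \<le> cmod c * R" using R(2)[OF c(2)] by (simp add: mult_left_mono)
  finally show "1 / R \<le> k" using R c by (simp add: field_simps)
qed

text \<open>Cauchy's estimate keeps \<open>kobayashi_royden\<close> at least \<open>1/R\<close> on
  unit vectors, so the supremum is finite at every radius; this allows the passage to the real
  function \<open>m\<close>.\<close>

lemma goldilocks_M_bounded:
  obtains R where "R > 0" "\<And>r. goldilocks_M \<Omega> r \<le> ennreal R"
proof -
  obtain R where R: "R > 0" "\<And>\<phi>. holomorphic_disc \<Omega> \<phi> \<Longrightarrow> norm (disc_deriv \<phi> 0) \<le> R"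
    using disc_deriv_bounded by blast
  show ?thesis
  proof (rule that[OF R(1)])
    fix r
    show "goldilocks_M \<Omega> r \<le> ennreal R"
      unfolding goldilocks_M_def
    proof (rule Sup_least, clarify)
      fix x and v :: "complex^'d" assume x: "x \<in> \<Omega>" and v: "norm v = 1"
      have k: "1 / R \<le> kobayashi_royden \<Omega> x v" by (rule kobayashi_royden_ge[OF R x v])
      moreover have "1 / R > 0" using R by simp
      ultimately have k0: "kobayashi_royden \<Omega> x v > 0" by linarith
      then have "1 / ennreal (kobayashi_royden \<Omega> x v) = ennreal (1 / kobayashi_royden \<Omega> x v)"
        using divide_ennreal[of 1] by simp
      also have "\<dots> \<le> ennreal R"
        using k k0 R by (intro ennreal_leI) (simp add: field_simps)
      finally show "1 / ennreal (kobayashi_royden \<Omega> x v) \<le> ennreal R" .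
    qed
  qed
qed

definition m :: "real \<Rightarrow> real" where "m r = enn2real (goldilocks_M \<Omega> r)"

lemma ennreal_m: "ennreal (m r) = goldilocks_M \<Omega> r"
proof -
  obtain R where "goldilocks_M \<Omega> r \<le> ennreal R" using goldilocks_M_bounded[of thesis] by blast
  then have "goldilocks_M \<Omega> r < top" using order_le_less_trans ennreal_less_top by blast
  then show ?thesis by (simp add: m_def)
qed

lemma m_nonneg: "0 \<le> m r" by (simp add: m_def)

lemma m_bounded: obtains R where "R > 0" "\<And>r. m r \<le> R"
proof -
  obtain R where R: "R > 0" "\<And>r. goldilocks_M \<Omega> r \<le> ennreal R" using goldilocks_M_bounded by blast
  show ?thesis
    using R by (intro that[of R]) (auto simp: ennreal_m[symmetric] m_nonneg)
qed

lemma m_mono: "r \<le> s \<Longrightarrow> m r \<le> m s"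
proof -
  assume "r \<le> s"
  then have "goldilocks_M \<Omega> r \<le> goldilocks_M \<Omega> s"
    unfolding goldilocks_M_def by (intro Sup_subset_mono) force
  then show ?thesis by (simp add: ennreal_m[symmetric] m_nonneg)
qed

text \<open>The disc itself competes in the infimum for the unit vector \<open>w\<close> in its
  direction, with value \<open>1 / norm v\<close>; reciprocals turn this into a bound by the
  supremum \<open>goldilocks_M\<close>.\<close>

lemma norm_disc_deriv_le:
  assumes \<phi>: "holomorphic_disc \<Omega> \<phi>"
  shows "norm (disc_deriv \<phi> 0) \<le> m (\<delta> (\<phi> 0))"
proof (cases "disc_deriv \<phi> 0 = 0")
  case True
  then show ?thesis by (simp add: m_nonneg)
next
  case False
  define v where "v = disc_deriv \<phi> 0"
  define w where "w = of_real (1 / norm v) *s v"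
  have v: "norm v > 0" using False by (simp add: v_def)
  have x: "\<phi> 0 \<in> \<Omega>" using holomorphic_discD[OF \<phi>, of 0] by simp
  have w: "norm w = 1" using v by (simp add: w_def norm_vector_smult norm_divide)
  have "cmod (of_real (1 / norm v)) \<in> {cmod c |c. \<exists>\<psi>. holomorphic_disc \<Omega> \<psi> \<and> \<psi> 0 = \<phi> 0 \<and> c *s disc_deriv \<psi> 0 = w}"
    unfolding mem_Collect_eq w_def v_def by (intro exI[of _ "of_real (1 / norm (disc_deriv \<phi> 0))"] exI[of _ \<phi>] conjI HOL.refl \<phi>)
  then have "kobayashi_royden \<Omega> (\<phi> 0) w \<le> cmod (of_real (1 / norm v))"
    unfolding kobayashi_royden_def by (rule cInf_lower) (auto intro: bdd_belowI[of _ 0])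
  also have "\<dots> = 1 / norm v" by (simp add: norm_divide)
  finally have le: "kobayashi_royden \<Omega> (\<phi> 0) w \<le> 1 / norm v" .
  have "ennreal (norm v) \<le> 1 / ennreal (kobayashi_royden \<Omega> (\<phi> 0) w)"
  proof (cases "kobayashi_royden \<Omega> (\<phi> 0) w \<le> 0")
    case True
    \<comment> \<open>\<open>ennreal\<close> truncates a nonpositive value to 0, and
      \<open>1 / 0\<close> is \<infinity>.\<close>
    then show ?thesis by (simp add: ennreal_neg)
  next
    case False
    then have "1 / ennreal (kobayashi_royden \<Omega> (\<phi> 0) w) = ennreal (1 / kobayashi_royden \<Omega> (\<phi> 0) w)"
      using divide_ennreal[of 1] by simp
    moreover have "norm v \<le> 1 / kobayashi_royden \<Omega> (\<phi> 0) w"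
      using le v False by (simp add: field_simps)
    ultimately show ?thesis by (simp add: ennreal_leI)
  qed
  also have "\<dots> \<le> goldilocks_M \<Omega> (\<delta> (\<phi> 0))"
    unfolding goldilocks_M_def using x w by (intro Sup_upper) auto
  finally show ?thesis by (simp add: ennreal_m[symmetric] m_nonneg v_def)
qed

section \<open>Paths parametrised by Poincare length\<close>

text \<open>The speed bound is stated through increments over intervals instead of derivatives: in
  this form it is additive under concatenation and ignores the corners where two discs meet.
  \<open>C\<close> has to dominate only on \<open>{s..t}\<close>, so it may shrink as the path nears
  the boundary.\<close>

definition unit_path :: "real \<Rightarrow> (real \<Rightarrow> complex^'d) \<Rightarrow> bool" where
  "unit_path T \<sigma> \<longleftrightarrow> 0 \<le> T \<and> \<sigma> ` {0..T} \<subseteq> \<Omega> \<and>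
     (\<forall>s t. 0 \<le> s \<and> s \<le> t \<and> t \<le> T \<longrightarrow> d (\<sigma> s) (\<sigma> t) \<le> t - s) \<and>
     (\<forall>s t C. 0 \<le> s \<and> s \<le> t \<and> t \<le> T \<and> (\<forall>u\<in>{s..t}. m (\<delta> (\<sigma> u)) \<le> C) \<longrightarrow> norm (\<sigma> t - \<sigma> s) \<le> C * (t - s))"

lemma unit_pathD:
  assumes "unit_path T \<sigma>"
  shows "0 \<le> T"
    and "0 \<le> t \<Longrightarrow> t \<le> T \<Longrightarrow> \<sigma> t \<in> \<Omega>"
    and "0 \<le> s \<Longrightarrow> s \<le> t \<Longrightarrow> t \<le> T \<Longrightarrow> d (\<sigma> s) (\<sigma> t) \<le> t - s"
    and "0 \<le> s \<Longrightarrow> s \<le> t \<Longrightarrow> t \<le> T \<Longrightarrow> (\<And>u. s \<le> u \<Longrightarrow> u \<le> t \<Longrightarrow> m (\<delta> (\<sigma> u)) \<le> C) \<Longrightarrow> norm (\<sigma> t - \<sigma> s) \<le> C * (t - s)"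
  using assms by (auto simp: unit_path_def)

text \<open>By the chain rule the velocity at time \<open>u\<close> is the derivative at 0 of the
  disc recentred at \<open>tanh u\<close>, to which \<open>norm_disc_deriv_le\<close> applies; the
  mean value inequality turns this into the increment bound.\<close>

lemma unit_path_disc:
  assumes \<psi>: "holomorphic_disc \<Omega> \<psi>" and T: "0 \<le> T"
  shows "unit_path T (\<lambda>t. \<psi> (of_real (tanh t)))"
  unfolding unit_path_def
proof (intro conjI allI impI T)
  have abs_tanh: "\<bar>tanh t\<bar> < 1" for t :: real
    using tanh_real_lt_1[of t] tanh_real_gt_neg1[of t] by linarith
  have ball: "of_real (tanh t) \<in> ball (0::complex) 1" for t
    using abs_tanh by simp
  show "(\<lambda>t. \<psi> (of_real (tanh t))) ` {0..T} \<subseteq> \<Omega>"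
    using holomorphic_discD[OF \<psi> ball] by auto
  show "d (\<psi> (of_real (tanh s))) (\<psi> (of_real (tanh t))) \<le> t - s" if "0 \<le> s \<and> s \<le> t \<and> t \<le> T" for s t
    using kobayashi_dist_le[OF disc_chain_single[OF \<psi> ball ball, of s t]] that
    by (simp add: poincare_dist_tanh)
  show "norm (\<psi> (of_real (tanh t)) - \<psi> (of_real (tanh s))) \<le> C * (t - s)"
    if "0 \<le> s \<and> s \<le> t \<and> t \<le> T \<and> (\<forall>u\<in>{s..t}. m (\<delta> (\<psi> (of_real (tanh u)))) \<le> C)" for s t C
  proof -
    define v where "v = (\<lambda>u. of_real (1 - (tanh u)\<^sup>2) *s disc_deriv \<psi> (of_real (tanh u)))"
    have der: "((\<lambda>t. \<psi> (of_real (tanh t))) has_derivative (\<lambda>h. h *\<^sub>R v u)) (at u within {s..t})" for u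
    proof -
      have "(tanh has_derivative (\<lambda>h. (1 - (tanh u)\<^sup>2) * h)) (at u)"
        unfolding has_field_derivative_def[symmetric]
        by (rule derivative_eq_intros refl | simp)+
      then have 1: "((\<lambda>t. of_real (tanh t) :: complex) has_derivative (\<lambda>h. of_real ((1 - (tanh u)\<^sup>2) * h))) (at u)"
        by (rule has_derivative_of_real)
      have "((\<lambda>t. \<psi> (of_real (tanh t))) has_derivative (\<lambda>h. of_real ((1 - (tanh u)\<^sup>2) * h) *s disc_deriv \<psi> (of_real (tanh u)))) (at u)"
        using diff_chain_at[OF 1 holomorphic_disc_has_derivative[OF \<psi> ball]] by (simp add: o_def)
      moreover have "of_real ((1 - (tanh u)\<^sup>2) * h) *s disc_deriv \<psi> (of_real (tanh u)) = h *\<^sub>R v u" for h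
        unfolding v_def vec_eq_iff by (simp add: scaleR_conv_of_real[where 'a=complex] algebra_simps)
      ultimately have "((\<lambda>t. \<psi> (of_real (tanh t))) has_derivative (\<lambda>h. h *\<^sub>R v u)) (at u)"
        by simp
      then show ?thesis by (rule has_derivative_at_withinI)
    qed
    have "norm (v u) \<le> C" if u: "u \<in> {s..t}" for u
    proof -
      obtain \<eta> where "holomorphic_disc \<Omega> \<eta>" "\<eta> 0 = \<psi> (of_real (tanh u))" "disc_deriv \<eta> 0 = v u"
        using disc_translate[OF \<psi>, of "tanh u"] abs_tanh[of u] unfolding v_def by blast
      then have "norm (v u) \<le> m (\<delta> (\<psi> (of_real (tanh u))))" using norm_disc_deriv_le by metis
      then show ?thesis using that \<open>0 \<le> s \<and> s \<le> t \<and> t \<le> T \<and> (\<forall>u\<in>{s..t}. m (\<delta> (\<psi> (of_real (tanh u)))) \<le> C)\<close> by force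
    qed
    then have "onorm (\<lambda>h. h *\<^sub>R v u) \<le> C" if "u \<in> {s..t}" for u
      using that by (simp add: onorm_scaleR_left_lemma onorm_scaleR_left bounded_linear_ident onorm_id)
    from differentiable_bound[OF _ der this, of t s] that
    show ?thesis by simp
  qed
qed

lemma unit_path_append:
  assumes \<sigma>: "unit_path T \<sigma>" and \<tau>: "unit_path T' \<tau>" and eq: "\<sigma> T = \<tau> 0"
  shows "unit_path (T + T') (\<lambda>t. if t \<le> T then \<sigma> t else \<tau> (t - T))"
    (is "unit_path _ ?\<rho>")
proof -
  note S = unit_pathD[OF \<sigma>] and U = unit_pathD[OF \<tau>]
  \<comment> \<open>By \<open>eq\<close> the two branches agree at \<open>T\<close>, so the second
    formula is valid at the junction as well.\<close>
  have \<rho>: "?\<rho> u = \<tau> (u - T)" if "T \<le> u" for u using eq that by auto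
  show ?thesis
    unfolding unit_path_def
  proof (intro conjI allI impI)
    show "0 \<le> T + T'" using S(1) U(1) by simp
    show im: "?\<rho> ` {0..T + T'} \<subseteq> \<Omega>" using S(2) U(2) by auto
    fix s t assume *: "0 \<le> s \<and> s \<le> t \<and> t \<le> T + T'"
    consider "t \<le> T" | "T \<le> s" | "s \<le> T" "T \<le> t" by linarith
    then show "d (?\<rho> s) (?\<rho> t) \<le> t - s"
    proof cases
      case 1
      then show ?thesis using * S(3)[of s t] by simp
    next
      case 2
      then show ?thesis using * U(3)[of "s - T" "t - T"] \<rho>[of s] \<rho>[of t] by simp
    next
      case 3
      have "d (\<sigma> s) (\<sigma> T) \<le> T - s" using S(3) 3 * by simp
      moreover have "d (\<tau> 0) (\<tau> (t - T)) \<le> t - T" using U(3)[of 0 "t - T"] 3 * by simp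
      moreover have "d (\<sigma> s) (\<tau> (t - T)) \<le> d (\<sigma> s) (\<sigma> T) + d (\<tau> 0) (\<tau> (t - T))"
        unfolding eq using S(1,2) U(1,2) 3 * by (intro kobayashi_dist_triangle) auto
      ultimately show ?thesis using \<rho>[of t] 3 by simp
    qed
  next
    fix s t C assume *: "0 \<le> s \<and> s \<le> t \<and> t \<le> T + T' \<and> (\<forall>u\<in>{s..t}. m (\<delta> (?\<rho> u)) \<le> C)"
    then have C: "m (\<delta> (?\<rho> u)) \<le> C" if "s \<le> u" "u \<le> t" for u using that by auto
    have \<sigma>C: "m (\<delta> (\<sigma> u)) \<le> C" if "s \<le> u" "u \<le> t" "u \<le> T" for u using C[of u] that by simp
    have \<tau>C: "m (\<delta> (\<tau> u)) \<le> C" if "s \<le> u + T" "u + T \<le> t" "0 \<le> u" for u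
      using C[of "u + T"] \<rho>[of "u + T"] that by simp
    consider "t \<le> T" | "T \<le> s" | "s \<le> T" "T \<le> t" by linarith
    then show "norm (?\<rho> t - ?\<rho> s) \<le> C * (t - s)"
    proof cases
      case 1
      then show ?thesis using * S(4)[of s t C] \<sigma>C by simp
    next
      case 2
      then show ?thesis using * U(4)[of "s - T" "t - T" C] \<tau>C \<rho>[of s] \<rho>[of t] by simp
    next
      case 3
      have "norm (\<sigma> T - \<sigma> s) \<le> C * (T - s)" using S(4)[of s T C] 3 * \<sigma>C by simp
      moreover have "norm (\<tau> (t - T) - \<tau> 0) \<le> C * (t - T)" using U(4)[of 0 "t - T" C] 3 * \<tau>C by simp
      moreover have "norm (\<tau> (t - T) - \<sigma> s) \<le> norm (\<tau> (t - T) - \<tau> 0) + norm (\<sigma> T - \<sigma> s)"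
        unfolding eq using norm_triangle_ineq[of "\<tau> (t - T) - \<tau> 0" "\<tau> 0 - \<sigma> s"] by simp
      moreover have "C * (t - s) = C * (t - T) + C * (T - s)" by (simp add: algebra_simps)
      ultimately show ?thesis using \<rho>[of t] 3 by simp
    qed
  qed
qed

lemma unit_path_disc_chain:
  assumes "disc_chain \<Omega> x y L" "x \<in> \<Omega>"
  shows "\<exists>\<sigma>. unit_path L \<sigma> \<and> \<sigma> 0 = x \<and> \<sigma> L = y"
  using assms
proof induction
  case (refl x)
  show ?case
  proof (intro exI[of _ "\<lambda>_. x"] conjI)
    show "unit_path 0 (\<lambda>_. x)"
      unfolding unit_path_def
    proof (intro conjI allI impI)
      fix s t C :: real
      assume "0 \<le> s \<and> s \<le> t \<and> t \<le> 0 \<and> (\<forall>u\<in>{s..t}. m (\<delta> x) \<le> C)"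
      then have "s = t" by simp
      then show "norm (x - x) \<le> C * (t - s)" by simp
    next
      fix s t :: real
      assume "0 \<le> s \<and> s \<le> t \<and> t \<le> 0"
      then show "d x x \<le> t - s" using kobayashi_dist_le[OF disc_chain.refl, of x] by linarith
    qed (use refl in auto)
  qed simp_all
next
  case (step x y L \<phi> a b z)
  obtain \<sigma> where \<sigma>: "unit_path L \<sigma>" "\<sigma> 0 = x" "\<sigma> L = y" using step by blast
  obtain \<psi> where \<psi>: "holomorphic_disc \<Omega> \<psi>" "\<psi> 0 = \<phi> a" "\<psi> (of_real (tanh (poincare_dist a b))) = \<phi> b"
    using disc_recentre step.hyps by metis
  have p0: "0 \<le> poincare_dist a b" using poincare_dist_nonneg step.hyps by simp
  define \<tau> where "\<tau> = (\<lambda>t. \<psi> (of_real (tanh t)))"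
  have \<tau>: "unit_path (poincare_dist a b) \<tau>" "\<tau> 0 = y" "\<tau> (poincare_dist a b) = z"
    using unit_path_disc[OF \<psi>(1) p0] \<psi> step.hyps by (auto simp: \<tau>_def)
  have "unit_path (L + poincare_dist a b) (\<lambda>t. if t \<le> L then \<sigma> t else \<tau> (t - L))"
    using \<sigma> \<tau> by (intro unit_path_append) auto
  moreover have "0 \<le> L" using \<sigma> unit_pathD by blast
  ultimately show ?case
    using \<sigma> \<tau> p0 by (intro exI conjI) (assumption, auto)
qed

lemma unit_path_exists:
  assumes "x \<in> \<Omega>" "y \<in> \<Omega>" "e > 0"
  obtains T \<sigma> where "unit_path T \<sigma>" "\<sigma> 0 = x" "\<sigma> T = y" "T < d x y + e"
  using kobayashi_dist_chain[OF assms(1,2), of "d x y + e"] unit_path_disc_chain assms by force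

text \<open>Since \<open>m\<close> is bounded by some \<open>R\<close>, every unit path is
  \<open>R\<close>-Lipschitz for the Euclidean norm, whence \<open>c = 1/R\<close>. The estimate
  along paths yields their continuity, the one between points converts Kobayashi closeness into
  Euclidean closeness.\<close>

lemma norm_le_kobayashi_dist:
  obtains c where "c > 0" "\<And>x y. x \<in> \<Omega> \<Longrightarrow> y \<in> \<Omega> \<Longrightarrow> c * norm (x - y) \<le> d x y"
    "\<And>T \<sigma> s t. unit_path T \<sigma> \<Longrightarrow> s \<in> {0..T} \<Longrightarrow> t \<in> {0..T} \<Longrightarrow> c * norm (\<sigma> t - \<sigma> s) \<le> \<bar>t - s\<bar>"
proof -
  obtain R where R: "R > 0" "\<And>r. m r \<le> R" using m_bounded by blast
  have p: "norm (\<sigma> t - \<sigma> s) \<le> R * \<bar>t - s\<bar>" if "unit_path T \<sigma>" "s \<in> {0..T}" "t \<in> {0..T}" for T \<sigma> s t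
  proof (cases "s \<le> t")
    case True
    then show ?thesis using unit_pathD(4)[OF that(1), of s t R] R that by simp
  next
    case False
    then show ?thesis using unit_pathD(4)[OF that(1), of t s R] R that by (simp add: norm_minus_commute)
  qed
  show ?thesis
  proof (rule that[of "1 / R"])
    show "1 / R > 0" using R by simp
    show "1 / R * norm (\<sigma> t - \<sigma> s) \<le> \<bar>t - s\<bar>" if "unit_path T \<sigma>" "s \<in> {0..T}" "t \<in> {0..T}" for T \<sigma> s t
      using p[OF that] R(1) by (simp add: field_simps)
    fix x y assume xy: "x \<in> \<Omega>" "y \<in> \<Omega>"
    show "1 / R * norm (x - y) \<le> d x y"
    proof (rule field_le_epsilon)
      fix e :: real assume "e > 0"
      then obtain T \<sigma> where T: "unit_path T \<sigma>" "\<sigma> 0 = x" "\<sigma> T = y" "T < d x y + e"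
        using unit_path_exists[OF xy] by blast
      have T0: "0 \<le> T" using unit_pathD(1)[OF T(1)] .
      have "norm (y - x) \<le> R * T" using p[OF T(1), of 0 T] T0 T by simp
      also have "\<dots> \<le> R * (d x y + e)" using R T by simp
      finally show "1 / R * norm (x - y) \<le> d x y + e"
        using R(1) by (simp add: field_simps norm_minus_commute)
    qed
  qed
qed

lemma continuous_on_unit_path:
  assumes "unit_path T \<sigma>"
  shows "continuous_on {0..T} \<sigma>"
proof -
  obtain c where c: "c > 0" "\<And>s t. s \<in> {0..T} \<Longrightarrow> t \<in> {0..T} \<Longrightarrow> c * norm (\<sigma> t - \<sigma> s) \<le> \<bar>t - s\<bar>"
    using norm_le_kobayashi_dist assms by metis
  show ?thesis
    unfolding continuous_on_iff
  proof (intro ballI allI impI)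
    fix s and e :: real assume s: "s \<in> {0..T}" and e: "e > 0"
    have "dist (\<sigma> t) (\<sigma> s) < e" if "t \<in> {0..T}" "dist t s < c * e" for t
    proof -
      have "c * norm (\<sigma> t - \<sigma> s) < c * e"
        using c(2)[OF s that(1)] that(2) by (simp add: dist_norm)
      then show ?thesis using c(1) by (simp add: dist_norm)
    qed
    moreover have "c * e > 0" using c e by simp
    ultimately show "\<exists>d>0. \<forall>x'\<in>{0..T}. dist x' s < d \<longrightarrow> dist (\<sigma> x') (\<sigma> s) < e" by blast
  qed
qed

section \<open>Distance to the boundary\<close>

lemma frontier_nonempty: "frontier \<Omega> \<noteq> {}"
  using domain_nonempty bounded_set by (auto simp: frontier_eq_empty)

lemma boundary_dist_pos: "x \<in> \<Omega> \<Longrightarrow> \<delta> x > 0"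
  unfolding boundary_dist_def
  using frontier_nonempty open_domain frontier_disjoint_eq[of \<Omega>]
  by (intro infdist_pos_not_in_closed) auto

lemma continuous_on_boundary_dist: "continuous_on S \<delta>"
  unfolding boundary_dist_def by (intro continuous_intros)

lemma boundary_dist_le: "\<delta> x \<le> \<delta> y + norm (x - y)"
  unfolding boundary_dist_def using infdist_triangle[of x "frontier \<Omega>" y] by (simp add: dist_norm)

lemma compact_boundary_dist_ge:
  assumes "r > 0"
  shows "compact {x \<in> \<Omega>. r \<le> \<delta> x}"
proof -
  \<comment> \<open>Frontier points have boundary distance 0, so with \<open>r > 0\<close> the
    closure adds nothing.\<close>
  have "{x \<in> \<Omega>. r \<le> \<delta> x} = closure \<Omega> \<inter> {x. r \<le> \<delta> x}"
    using assms open_domain closure_subset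
    by (auto simp: frontier_def interior_open boundary_dist_def)
       (metis Diff_iff frontier_def infdist_zero interior_open not_less)
  moreover have "closed {x. r \<le> \<delta> x}"
    using continuous_on_boundary_dist by (intro closed_Collect_le) auto
  ultimately show ?thesis
    using bounded_set by (simp add: compact_Int_closed compact_closure)
qed

end

section \<open>Visibility\<close>

text \<open>A telescoping sum over unit intervals. The end \<open>S\<close> of the path need not be
  an integer; nonnegativity of \<open>g\<close> absorbs the intervals past \<open>t\<close>.\<close>

lemma norm_diff_le_sum_unit_steps:
  fixes \<sigma> :: "real \<Rightarrow> 'a::real_normed_vector"
  assumes step: "\<And>k s t. \<lbrakk>real k \<le> s; s \<le> t; t \<le> real k + 1; t \<le> S\<rbrakk> \<Longrightarrow> norm (\<sigma> t - \<sigma> s) \<le> g k"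
    and nonneg: "\<And>k. 0 \<le> g k" and t: "0 \<le> t" "t \<le> S" "t \<le> real N"
  shows "norm (\<sigma> t - \<sigma> 0) \<le> (\<Sum>k<N. g k)"
  using t
proof (induction N arbitrary: t)
  case 0
  then show ?case by simp
next
  case (Suc N)
  show ?case
  proof (cases "t \<le> real N")
    case True
    then show ?thesis using Suc.IH[of t] Suc.prems nonneg[of N] by simp
  next
    case False
    have "norm (\<sigma> t - \<sigma> 0) \<le> norm (\<sigma> t - \<sigma> N) + norm (\<sigma> N - \<sigma> 0)"
      using norm_triangle_ineq[of "\<sigma> t - \<sigma> N" "\<sigma> N - \<sigma> 0"] by simp
    also have "norm (\<sigma> t - \<sigma> N) \<le> g N" using False Suc.prems by (intro step) auto
    also have "norm (\<sigma> N - \<sigma> 0) \<le> (\<Sum>k<N. g k)" using False Suc.prems by (intro Suc.IH) auto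
    finally show ?thesis by simp
  qed
qed

locale goldilocks = bdd_domain +
  assumes goldilocks: "goldilocks_domain \<Omega>"
begin

text \<open>On the \<open>k\<close>-th interval of the geometric partition, the weight \<open>1 / r\<close> contributes the
  constant factor \<open>1 - q\<close> at least.\<close>

lemma summable_m:
  assumes q: "0 < q" "q < 1" and A: "0 < A"
  shows "summable (\<lambda>k. m (A * q ^ k))"
proof -
  obtain \<epsilon> where \<epsilon>: "\<epsilon> > 0" and fin: "(\<integral>\<^sup>+ r\<in>{0<..<\<epsilon>}. (1 / ennreal r) * goldilocks_M \<Omega> r \<partial>lborel) < \<infinity>"
    using goldilocks by (auto simp: goldilocks_domain_def)
  define I where "I = (\<integral>\<^sup>+ r\<in>{0<..<\<epsilon>}. (1 / ennreal r) * goldilocks_M \<Omega> r \<partial>lborel)"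
  have "(\<lambda>k. A * q ^ k) \<longlonglongrightarrow> A * 0"
    using q by (intro tendsto_mult tendsto_const LIMSEQ_realpow_zero) auto
  then have "\<forall>\<^sub>F k in sequentially. A * q ^ k < \<epsilon>"
    using \<epsilon> by (simp add: order_tendstoD)
  \<comment> \<open>The first \<open>k0\<close> points are skipped so that the rest of the partition
    lies inside \<open>{0<..<\<epsilon>}\<close>.\<close>
  then obtain k0 where k0: "A * q ^ k0 < \<epsilon>" by (auto simp: eventually_sequentially)
  define a where "a k = A * q ^ (k0 + k)" for k
  \<comment> \<open>On \<open>J k\<close> the monotone \<open>m\<close> is at least its value at the
    left end and \<open>1 / r\<close> at least its value at the right end, so \<open>c k\<close> is
    a lower bound for \<open>m r / r\<close> there.\<close>
  define c where "c k = m (a (Suc k)) / a k" for k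
  define J where "J k = {a (Suc k)<..<a k}" for k
  have a_pos: "a k > 0" for k using q A by (simp add: a_def)
  have a_anti: "a k \<le> a j" if "j \<le> k" for j k
    using that q A by (simp add: a_def power_decreasing)
  have a_Suc: "a (Suc k) = q * a k" for k by (simp add: a_def)
  have a_less: "a k < \<epsilon>" for k using a_anti[of 0 k] k0 by (simp add: a_def)
  have c_nonneg: "0 \<le> c k" for k using a_pos[of k] m_nonneg by (simp add: c_def)
  have pointwise: "(\<Sum>k<N. ennreal (c k) * indicator (J k) r)
      \<le> (1 / ennreal r) * goldilocks_M \<Omega> r * indicator {0<..<\<epsilon>} r" for N :: nat and r :: real
  proof (cases "\<exists>j<N. r \<in> J j")
    case True
    then obtain j where j: "j < N" "r \<in> J j" by blast
    have "r \<notin> J k" if "k \<noteq> j" for k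
      using that j a_anti[of "Suc k" j] a_anti[of "Suc j" k] by (cases "k < j") (auto simp: J_def)
    then have "(\<Sum>k<N. ennreal (c k) * indicator (J k) r) = (\<Sum>k<N. if k = j then ennreal (c j) else 0)"
      using j by (intro sum.cong) auto
    also have "\<dots> = ennreal (c j)" using j by simp
    also have "\<dots> \<le> ennreal (1 / r * m r)"
    proof (rule ennreal_leI)
      have r: "a (Suc j) < r" "r < a j" using j by (auto simp: J_def)
      then have "0 < r" using a_pos[of "Suc j"] by linarith
      have "1 / a j * m (a (Suc j)) \<le> 1 / r * m r"
        using r \<open>0 < r\<close> m_mono m_nonneg by (intro mult_mono divide_left_mono) auto
      then show "c j \<le> 1 / r * m r" by (simp add: c_def)
    qed
    also have "\<dots> = (1 / ennreal r) * goldilocks_M \<Omega> r"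
    proof -
      have "0 < r" using j a_pos[of "Suc j"] by (auto simp: J_def)
      then have "1 / ennreal r = ennreal (1 / r)" using divide_ennreal[of 1 r] by simp
      moreover have "ennreal (1 / r * m r) = ennreal (1 / r) * ennreal (m r)"
        using \<open>0 < r\<close> by (intro ennreal_mult) (auto simp: m_nonneg)
      ultimately show ?thesis by (simp only: ennreal_m)
    qed
    also have "\<dots> = (1 / ennreal r) * goldilocks_M \<Omega> r * indicator {0<..<\<epsilon>} r"
      using j a_pos[of "Suc j"] a_less[of j] by (auto simp: J_def)
    finally show ?thesis .
  next
    case False
    then have "(\<Sum>k<N. ennreal (c k) * indicator (J k) r) = 0" by (auto intro!: sum.neutral)
    then show ?thesis by simp
  qed
  have bound: "ennreal ((1 - q) * (\<Sum>k<N. m (a (Suc k)))) \<le> I" for N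
  proof -
    have "(\<integral>\<^sup>+ r. (\<Sum>k<N. ennreal (c k) * indicator (J k) r) \<partial>lborel)
        = (\<Sum>k<N. \<integral>\<^sup>+ r. ennreal (c k) * indicator (J k) r \<partial>lborel)"
      by (rule nn_integral_sum) (simp add: J_def)
    also have "\<dots> = (\<Sum>k<N. ennreal ((1 - q) * m (a (Suc k))))"
    proof (rule sum.cong[OF HOL.refl])
      fix k
      have "(\<integral>\<^sup>+ r. ennreal (c k) * indicator (J k) r \<partial>lborel) = ennreal (c k) * ennreal (a k - a (Suc k))"
        using a_anti[of k "Suc k"] by (simp add: nn_integral_cmult_indicator J_def)
      also have "\<dots> = ennreal (c k * (a k - a (Suc k)))"
        using c_nonneg a_anti[of k "Suc k"] by (simp add: ennreal_mult)
      also have "c k * (a k - a (Suc k)) = (1 - q) * m (a (Suc k))"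
        using a_pos[of k] unfolding c_def a_Suc by (simp add: field_simps)
      finally show "(\<integral>\<^sup>+ r. ennreal (c k) * indicator (J k) r \<partial>lborel) = ennreal ((1 - q) * m (a (Suc k)))" .
    qed
    also have "\<dots> = ennreal ((1 - q) * (\<Sum>k<N. m (a (Suc k))))"
      using q m_nonneg by (simp add: sum_ennreal sum_distrib_left)
    finally have "ennreal ((1 - q) * (\<Sum>k<N. m (a (Suc k))))
      = (\<integral>\<^sup>+ r. (\<Sum>k<N. ennreal (c k) * indicator (J k) r) \<partial>lborel)" by (rule HOL.sym)
    also have "\<dots> \<le> I"
      unfolding I_def by (rule nn_integral_mono) (rule pointwise)
    finally show ?thesis .
  qed
  obtain x where x: "x \<ge> 0" "I = ennreal x" using fin unfolding I_def[symmetric]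
    by (cases I) auto
  have "summable (\<lambda>k. m (a (Suc k)))"
  proof (rule summableI_nonneg_bounded)
    fix N
    have "(1 - q) * (\<Sum>k<N. m (a (Suc k))) \<le> x"
      using bound[of N] x by (simp add: ennreal_le_iff)
    then show "(\<Sum>k<N. m (a (Suc k))) \<le> x / (1 - q)"
      using q by (simp add: field_simps)
  qed (rule m_nonneg)
  then have "summable (\<lambda>k. m (A * q ^ (k + Suc k0)))"
    by (simp add: a_def add.commute)
  then show ?thesis by (subst (asm) summable_iff_shift)
qed

text \<open>Convergence of the series forces \<open>m\<close> to 0 along a geometric sequence: in
  all unit directions the Kobayashi metric blows up at the boundary.\<close>

lemma m_small:
  assumes "e > 0"
  obtains r where "r > 0" "m r < e"
proof -
  have "(\<lambda>k. m (1 * (1/2) ^ k)) \<longlonglongrightarrow> 0"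
    by (intro summable_LIMSEQ_zero summable_m) auto
  then have "\<forall>\<^sub>F k in sequentially. m (1 * (1/2) ^ k) < e" using assms by (rule order_tendstoD)
  then obtain k where "m (1 * (1/2) ^ k) < e" by (auto simp: eventually_sequentially)
  then show ?thesis by (intro that[of "1 * (1/2) ^ k"]) auto
qed

text \<open>The tail of the series is small whatever \<open>r\<close> is, and each of the first
  \<open>K\<close> terms is at most \<open>m r\<close>. The truncated sum will bound the Euclidean
  displacement along one half of a nearly minimal path that stays within \<open>r\<close> of the
  boundary; uniformity in \<open>N\<close> is essential because the lengths of such paths are
  unbounded.\<close>

lemma sum_m_min_small:
  assumes q: "0 < q" "q < 1" and A: "0 < A" and e: "0 < e"
  obtains r where "r > 0" "\<And>N. (\<Sum>k<N. m (min r (A * q ^ k))) < e"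
proof -
  let ?f = "\<lambda>k. m (A * q ^ k)"
  have s: "summable ?f" by (rule summable_m[OF q A])
  obtain K where K: "norm (\<Sum>i. ?f (i + K)) < e / 2"
    using suminf_exist_split[OF _ s, of "e/2"] e by auto
  obtain r where r: "r > 0" "m r < e / (2 * (real K + 1))"
    using m_small[of "e / (2 * (real K + 1))"] e by auto
  show ?thesis
  proof (rule that[OF r(1)])
    fix N
    let ?g = "\<lambda>k. m (min r (A * q ^ k))"
    have "(\<Sum>k<N. ?g k) \<le> (\<Sum>k<K+N. ?g k)" by (intro sum_mono2) (auto simp: m_nonneg)
    also have "\<dots> = (\<Sum>k<K. ?g k) + (\<Sum>k\<in>{K..<K+N}. ?g k)"
      by (simp add: lessThan_atLeast0 sum.atLeastLessThan_concat)
    also have "(\<Sum>k\<in>{K..<K+N}. ?g k) = (\<Sum>k<N. ?g (k + K))"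
      using sum.shift_bounds_nat_ivl[of ?g 0 K N] by (simp add: lessThan_atLeast0 add.commute)
    also have "(\<Sum>k<N. ?g (k + K)) \<le> (\<Sum>k<N. ?f (k + K))" by (intro sum_mono m_mono) auto
    also have "\<dots> \<le> (\<Sum>i. ?f (i + K))"
      using summable_ignore_initial_segment[OF s, of K] by (intro sum_le_suminf) (auto simp: m_nonneg)
    also have "\<dots> < e / 2" using K by simp
    also have "(\<Sum>k<K. ?g k) \<le> (\<Sum>k<K. m r)" by (intro sum_mono m_mono) auto
    also have "\<dots> = real K * m r" by simp
    also have "\<dots> \<le> (real K + 1) * m r" using m_nonneg by (intro mult_right_mono) auto
    also have "\<dots> \<le> e / 2" using r(2) by (simp add: field_simps)
    finally show "(\<Sum>k<N. ?g k) < e" by simp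
  qed
qed

text \<open>A nearly minimal path between two distant points cannot stay close to the boundary: away from
  its point of largest boundary distance, the boundary distance decays exponentially in the
  parameter by the growth condition, so its Euclidean speed is dominated by an integrable function.\<close>

theorem visibility:
  assumes e: "e > 0"
  obtains r where "r > 0"
    "\<And>x y \<kappa>. \<lbrakk>x \<in> \<Omega>; y \<in> \<Omega>; e \<le> norm (x - y); 0 < \<kappa>; \<kappa> \<le> 1\<rbrakk>
       \<Longrightarrow> \<exists>z\<in>\<Omega>. r \<le> \<delta> z \<and> d x z + d z y \<le> d x y + \<kappa>"
proof -
  obtain o' where o': "o' \<in> \<Omega>" using domain_nonempty by blast
  obtain C \<alpha> where \<alpha>: "\<alpha> > 0" and growth: "\<And>x. x \<in> \<Omega> \<Longrightarrow> d o' x \<le> C + \<alpha> * ln (1 / \<delta> x)"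
    using goldilocks o' unfolding goldilocks_domain_def by meson
  \<comment> \<open>\<open>q\<close> and \<open>A\<close> come from solving \<open>\<bar>t -
    t0\<bar> - 1 \<le> 2 * C + 2 * \<alpha> * ln (1 / \<delta> (\<sigma> t))\<close> for the
    boundary distance. The factors 2 arise because the growth condition is used at both
    \<open>t\<close> and \<open>t0\<close>.\<close>
  define q where "q = exp (- 1 / (2 * \<alpha>))"
  define A where "A = exp ((2 * C + 1) / (2 * \<alpha>))"
  have q: "0 < q" "q < 1" and A: "0 < A" using \<alpha> by (auto simp: q_def A_def)
  obtain r where r: "r > 0" and small: "\<And>N. (\<Sum>k<N. m (min r (A * q ^ k))) < e / 2"
    using sum_m_min_small[OF q A, of "e/2"] e by auto
  show ?thesis
  proof (rule that[OF r])
    fix x y and \<kappa> :: real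
    assume x: "x \<in> \<Omega>" and y: "y \<in> \<Omega>" and xy: "e \<le> norm (x - y)" and \<kappa>: "0 < \<kappa>" "\<kappa> \<le> 1"
    obtain T \<sigma> where \<sigma>: "unit_path T \<sigma>" "\<sigma> 0 = x" "\<sigma> T = y" "T < d x y + \<kappa>"
      using unit_path_exists[OF x y \<kappa>(1)] by blast
    note P = unit_pathD[OF \<sigma>(1)]
    show "\<exists>z\<in>\<Omega>. r \<le> \<delta> z \<and> d x z + d z y \<le> d x y + \<kappa>"
    proof (rule ccontr)
      assume contra: "\<not> ?thesis"
      have near: "\<delta> (\<sigma> t) < r" if "0 \<le> t" "t \<le> T" for t
      proof (rule ccontr)
        assume "\<not> \<delta> (\<sigma> t) < r"
        moreover have "d x (\<sigma> t) + d (\<sigma> t) y \<le> d x y + \<kappa>"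
          using P(3)[of 0 t] P(3)[of t T] that \<sigma> by simp
        ultimately show False using contra P(2) that by auto
      qed
      have "continuous_on {0..T} (\<lambda>t. \<delta> (\<sigma> t))"
        using continuous_on_compose2[OF continuous_on_boundary_dist continuous_on_unit_path[OF \<sigma>(1)]] by auto
      then obtain t0 where t0: "0 \<le> t0" "t0 \<le> T" and max: "\<And>t. 0 \<le> t \<Longrightarrow> t \<le> T \<Longrightarrow> \<delta> (\<sigma> t) \<le> \<delta> (\<sigma> t0)"
        using continuous_attains_sup[of "{0..T}" "\<lambda>t. \<delta> (\<sigma> t)"] P(1) by auto
      \<comment> \<open>The path exceeds \<open>d x y\<close> in length by less than \<kappa> \<le>
        1, so no piece of it exceeds the distance of its ends by more than 1.\<close>
      have far: "\<bar>s - t\<bar> - 1 \<le> d (\<sigma> s) (\<sigma> t)" if "0 \<le> s" "s \<le> T" "0 \<le> t" "t \<le> T" for s t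
      proof -
        have *: "t - s - 1 \<le> d (\<sigma> s) (\<sigma> t)" if "0 \<le> s" "s \<le> t" "t \<le> T" for s t
        proof -
          have "d x y \<le> d x (\<sigma> s) + d (\<sigma> s) y"
            using x y P(2) that by (intro kobayashi_dist_triangle) auto
          moreover have "d (\<sigma> s) y \<le> d (\<sigma> s) (\<sigma> t) + d (\<sigma> t) y"
            using x y P(2) that by (intro kobayashi_dist_triangle) auto
          moreover have "d x (\<sigma> s) \<le> s" using P(3)[of 0 s] \<sigma> that by simp
          moreover have "d (\<sigma> t) y \<le> T - t" using P(3)[of t T] \<sigma> that by simp
          ultimately show ?thesis using \<sigma>(4) \<kappa> by linarith
        qed
        show ?thesis
          using *[of s t] *[of t s] that kobayashi_dist_commute by (cases "s \<le> t") auto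
      qed
      have decay: "\<delta> (\<sigma> t) \<le> A * q ^ k" if t: "0 \<le> t" "t \<le> T" "real k \<le> \<bar>t - t0\<bar>" for t k
      proof -
        have pos: "\<delta> (\<sigma> t) > 0" using boundary_dist_pos P(2) t by blast
        have "\<bar>t - t0\<bar> - 1 \<le> d (\<sigma> t) (\<sigma> t0)" using far t t0 by blast
        also have "\<dots> \<le> d (\<sigma> t) o' + d o' (\<sigma> t0)"
          using o' P(2) t t0 by (intro kobayashi_dist_triangle) auto
        also have "d (\<sigma> t) o' \<le> C + \<alpha> * ln (1 / \<delta> (\<sigma> t))"
          using growth[of "\<sigma> t"] P(2) t by (simp add: kobayashi_dist_commute)
        also have "d o' (\<sigma> t0) \<le> C + \<alpha> * ln (1 / \<delta> (\<sigma> t0))" using growth P(2) t0 by blast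
        also have "\<dots> \<le> C + \<alpha> * ln (1 / \<delta> (\<sigma> t))"
        proof -
          \<comment> \<open>At the maximum \<open>t0\<close> the logarithmic term is smallest, so
            the term at \<open>t\<close> can replace it.\<close>
          have "\<delta> (\<sigma> t) \<le> \<delta> (\<sigma> t0)" using max t by blast
          then have "1 / \<delta> (\<sigma> t0) \<le> 1 / \<delta> (\<sigma> t)" "0 < 1 / \<delta> (\<sigma> t0)"
            using pos by (auto simp: field_simps)
          then have "ln (1 / \<delta> (\<sigma> t0)) \<le> ln (1 / \<delta> (\<sigma> t))" using pos by (subst ln_le_cancel_iff) auto
          then show ?thesis using \<alpha> by simp
        qed
        finally have "real k \<le> 2 * C + 1 - 2 * \<alpha> * ln (\<delta> (\<sigma> t))"
          using t(3) pos by (simp add: ln_div algebra_simps)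
        then have "ln (\<delta> (\<sigma> t)) \<le> (2 * C + 1 - real k) / (2 * \<alpha>)"
          using \<alpha> by (simp add: pos_le_divide_eq mult.commute)
        then have "ln (\<delta> (\<sigma> t)) \<le> (2 * C + 1) / (2 * \<alpha>) + real k * (- 1 / (2 * \<alpha>))"
          by (simp add: diff_divide_distrib)
        then have "exp (ln (\<delta> (\<sigma> t))) \<le> exp ((2 * C + 1) / (2 * \<alpha>) + real k * (- 1 / (2 * \<alpha>)))"
          by (simp only: exp_le_cancel_iff)
        also have "\<dots> = A * q ^ k" by (simp only: exp_add exp_of_nat_mult A_def q_def)
        finally show ?thesis using pos by simp
      qed
      define g where "g k = m (min r (A * q ^ k))" for k
      have g: "0 \<le> g k" for k by (simp add: g_def m_nonneg)
      have mg: "m (\<delta> (\<sigma> u)) \<le> g k" if "0 \<le> u" "u \<le> T" "real k \<le> \<bar>u - t0\<bar>" for u k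
        unfolding g_def using decay[OF that] near[OF that(1,2)] by (intro m_mono) simp
      have step: "norm (\<sigma> t - \<sigma> s) \<le> g k"
        if st: "0 \<le> s" "s \<le> t" "t \<le> T" "t - s \<le> 1" "\<And>u. s \<le> u \<Longrightarrow> u \<le> t \<Longrightarrow> real k \<le> \<bar>u - t0\<bar>" for s t k
      proof -
        have "norm (\<sigma> t - \<sigma> s) \<le> g k * (t - s)"
          using st by (intro P(4) mg) auto
        also have "\<dots> \<le> g k" using st g by (intro mult_right_le_one_le) auto
        finally show ?thesis .
      qed
      obtain N :: nat where N: "T \<le> real N" using real_arch_simple by blast
      have "norm (\<sigma> (t0 + (T - t0)) - \<sigma> (t0 + 0)) \<le> (\<Sum>k<N. g k)"
      proof (rule norm_diff_le_sum_unit_steps[where \<sigma>="\<lambda>u. \<sigma> (t0 + u)" and S="T - t0"])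
        fix k s t assume "real k \<le> s" "s \<le> t" "t \<le> real k + 1" "t \<le> T - t0"
        then show "norm (\<sigma> (t0 + t) - \<sigma> (t0 + s)) \<le> g k" using t0 by (intro step) auto
      qed (use g t0 N in auto)
      then have 1: "norm (y - \<sigma> t0) < e / 2" using small[of N] \<sigma> by (simp add: g_def)
      \<comment> \<open>The other half of the path, run backwards from \<open>t0\<close>.\<close>
      have "norm (\<sigma> (t0 - t0) - \<sigma> (t0 - 0)) \<le> (\<Sum>k<N. g k)"
      proof (rule norm_diff_le_sum_unit_steps[where \<sigma>="\<lambda>u. \<sigma> (t0 - u)" and S="t0"])
        fix k s t assume "real k \<le> s" "s \<le> t" "t \<le> real k + 1" "t \<le> t0"
        then have "norm (\<sigma> (t0 - s) - \<sigma> (t0 - t)) \<le> g k" using t0 by (intro step) auto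
        then show "norm (\<sigma> (t0 - t) - \<sigma> (t0 - s)) \<le> g k" by (simp add: norm_minus_commute)
      qed (use g t0 N in auto)
      then have 2: "norm (x - \<sigma> t0) < e / 2" using small[of N] \<sigma> by (simp add: g_def)
      have "norm (x - y) \<le> norm (x - \<sigma> t0) + norm (y - \<sigma> t0)"
        using norm_triangle_ineq4[of "x - \<sigma> t0" "y - \<sigma> t0"] by simp
      then show False using 1 2 xy by linarith
    qed
  qed
qed

end

section \<open>Iteration\<close>

text \<open>A finite subcover reduces the claim to finitely many eventualities; this is the passage
  from local statements to uniformity on compact sets.\<close>

lemma eventually_ball_compact:
  assumes S: "compact S"
    and local: "\<And>s. s \<in> S \<Longrightarrow> \<exists>U. open U \<and> s \<in> U \<and> (\<forall>\<^sub>F n in F. \<forall>u\<in>U \<inter> S. P n u)"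
  shows "\<forall>\<^sub>F n in F. \<forall>u\<in>S. P n u"
proof -
  obtain U where U: "\<And>s. s \<in> S \<Longrightarrow> open (U s) \<and> s \<in> U s \<and> (\<forall>\<^sub>F n in F. \<forall>u\<in>U s \<inter> S. P n u)"
    using local by metis
  obtain C where C: "C \<subseteq> S" "finite C" "S \<subseteq> (\<Union>s\<in>C. U s)"
    by (rule compactE_image[OF S, of S U]) (use U in auto)
  have "\<forall>\<^sub>F n in F. \<forall>s\<in>C. \<forall>u\<in>U s \<inter> S. P n u"
    using C U by (intro eventually_ball_finite) auto
  then show ?thesis by eventually_elim (use C in blast)
qed

section \<open>Self-maps and relatively compact orbits\<close>

locale goldilocks_map = goldilocks \<Omega> for \<Omega> :: "(complex^'d) set" +
  fixes f :: "complex^'d \<Rightarrow> complex^'d"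
  assumes holomorphic: "holomorphic_map_on f \<Omega>" and self: "f ` \<Omega> \<subseteq> \<Omega>"
begin

lemma iterate_in: "x \<in> \<Omega> \<Longrightarrow> (f ^^ n) x \<in> \<Omega>"
  by (induction n) (use self in auto)

lemma holomorphic_disc_iterate: "holomorphic_disc \<Omega> \<phi> \<Longrightarrow> holomorphic_disc \<Omega> (f ^^ n \<circ> \<phi>)"
  by (induction n) (use holomorphic_disc_map[OF _ holomorphic self] in \<open>auto simp: comp_assoc\<close>)

lemma iterate_nonexpanding:
  assumes "x \<in> \<Omega>" "y \<in> \<Omega>"
  shows "d ((f ^^ n) x) ((f ^^ n) y) \<le> d x y"
proof (induction n)
  case (Suc n)
  then show ?case
    using kobayashi_dist_map_le[OF holomorphic self iterate_in[OF assms(1), of n] iterate_in[OF assms(2), of n]] by simp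
qed simp

lemma continuous_on_iterate: "continuous_on \<Omega> (f ^^ n)"
proof (induction n)
  case (Suc n)
  have "(f ^^ n) ` \<Omega> \<subseteq> \<Omega>" using iterate_in by blast
  then have "continuous_on ((f ^^ n) ` \<Omega>) f"
    using holomorphic_map_on_imp_continuous_on[OF holomorphic] continuous_on_subset by blast
  with Suc show ?case by (simp add: continuous_on_compose del: comp_apply)
qed simp

text \<open>Nonexpansiveness bounds the gaps between successive visits of the orbit to a small ball around
  the cluster point.\<close>

lemma relatively_compact_orbit_if_cluster_point:
  assumes x: "x \<in> \<Omega>" and y: "y \<in> \<Omega>"
    and cluster: "\<And>e. e > 0 \<Longrightarrow> \<exists>\<^sub>F n in sequentially. norm ((f ^^ n) x - y) < e"
  shows "relatively_compact_in \<Omega> {(f ^^ n) x | n. True}"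
proof -
  define a where "a n = (f ^^ n) x" for n
  have a: "a n \<in> \<Omega>" for n using iterate_in[OF x] by (simp add: a_def)
  have a_add: "a (n + t) = (f ^^ t) (a n)" for n t by (simp add: a_def add.commute[of n] funpow_add)
  obtain s where s: "s > 0" "cball y s \<subseteq> \<Omega>" using y open_domain open_contains_cball by blast
  obtain c where c: "c > 0" "\<And>u v. u \<in> \<Omega> \<Longrightarrow> v \<in> \<Omega> \<Longrightarrow> c * norm (u - v) \<le> d u v"
    by (rule norm_le_kobayashi_dist) blast
  \<comment> \<open>With this radius the Kobayashi ball about \<open>y\<close> lies in the compact
    set \<open>cball y s\<close>.\<close>
  define \<rho> where "\<rho> = c * s"
  have \<rho>: "\<rho> > 0" using c s by (simp add: \<rho>_def)
  define J where "J = {n. d (a n) y < \<rho>}"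
  have J_cball: "a n \<in> cball y s" if "n \<in> J" for n
  proof -
    have "c * norm (a n - y) < c * s" using c(2)[OF a y, of n] that by (simp add: J_def \<rho>_def)
    then show ?thesis using c(1) by (simp add: dist_norm norm_minus_commute)
  qed
  have freq: "\<exists>\<^sub>F n in sequentially. d (a n) y < e" if e: "e > 0" for e
  proof -
    obtain r where r: "r > 0" "\<And>w. w \<in> ball y r \<Longrightarrow> d y w < e"
      using kobayashi_dist_small[OF y e] by metis
    show ?thesis
    proof (rule frequently_elim1[OF cluster[OF r(1)]])
      fix n assume "norm ((f ^^ n) x - y) < r"
      then have "a n \<in> ball y r" by (simp add: a_def dist_norm norm_minus_commute)
      from r(2)[OF this] show "d (a n) y < e" by (subst kobayashi_dist_commute)
    qed
  qed
  have "\<exists>r>0. ball z r \<subseteq> \<Omega> \<and> (\<forall>w\<in>ball z r. d z w < \<rho> / 4)" if "z \<in> cball y s" for z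
    using kobayashi_dist_small[of z "\<rho> / 4"] that s \<rho> by (metis divide_pos_pos subsetD zero_less_numeral)
  then obtain r where r: "\<And>z. z \<in> cball y s \<Longrightarrow> r z > 0 \<and> ball z (r z) \<subseteq> \<Omega> \<and> (\<forall>w\<in>ball z (r z). d z w < \<rho> / 4)"
    by metis
  obtain Z where Z: "Z \<subseteq> cball y s" "finite Z" "cball y s \<subseteq> (\<Union>z\<in>Z. ball z (r z))"
    by (rule compactE_image[of "cball y s" "cball y s" "\<lambda>z. ball z (r z)"]) (use r in auto)
  \<comment> \<open>One visit \<open>k\<close> to a small ball and one later time \<open>p\<close>
    close to \<open>y\<close> settle every visit \<open>n\<close> to that ball: after
    \<open>p - k\<close> more steps the orbit is within \<rho>/4 + \<rho>/4 of \<open>a p\<close>,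
    which is within \<rho>/2 of \<open>y\<close>. For a ball never visited the claim is
    vacuous.\<close>
  have "\<exists>t>0. \<forall>n. a n \<in> ball z (r z) \<longrightarrow> n + t \<in> J" if z: "z \<in> Z" for z
  proof (cases "\<exists>k. a k \<in> ball z (r z)")
    case True
    then obtain k where k: "a k \<in> ball z (r z)" by blast
    have "\<exists>p>k. d (a p) y < \<rho> / 2"
      using freq[of "\<rho> / 2"] \<rho> by (auto simp: frequently_sequentially) (metis Suc_le_eq)
    then obtain p where p: "p > k" "d (a p) y < \<rho> / 2" by blast
    have z': "z \<in> \<Omega>" using z Z s by blast
    have near: "d z w < \<rho> / 4" if "w \<in> ball z (r z)" for w using r z Z that by blast
    have "n + (p - k) \<in> J" if n: "a n \<in> ball z (r z)" for n
    proof -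
      have "d (a (n + (p - k))) y \<le> d (a (n + (p - k))) (a p) + d (a p) y"
        using a y by (intro kobayashi_dist_triangle)
      also have "d (a (n + (p - k))) (a p) \<le> d (a n) (a k)"
        using iterate_nonexpanding[OF a a, of "p - k" n k] p(1) by (simp flip: a_add)
      also have "\<dots> \<le> d (a n) z + d z (a k)" using a z' by (intro kobayashi_dist_triangle)
      finally show ?thesis
        using near[OF k] near[OF n] p(2) by (simp add: J_def kobayashi_dist_commute)
    qed
    then show ?thesis using p(1) by (intro exI[of _ "p - k"]) auto
  qed auto
  then obtain t where t: "\<And>z n. z \<in> Z \<Longrightarrow> t z > 0 \<and> (a n \<in> ball z (r z) \<longrightarrow> n + t z \<in> J)"
    by metis
  define T where "T = sum t Z"
  have next_visit: "\<exists>t>0. t \<le> T \<and> n + t \<in> J" if n: "n \<in> J" for n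
  proof -
    obtain z where "z \<in> Z" "a n \<in> ball z (r z)" using J_cball[OF n] Z by blast
    moreover have "t z \<le> T" unfolding T_def using Z calculation by (intro member_le_sum) auto
    ultimately show ?thesis using t by blast
  qed
  have "\<exists>n. n \<in> J" using freq[OF \<rho>] by (auto simp: J_def frequently_sequentially)
  then obtain n0 where n0: "n0 \<in> J" by blast
  have last_visit: "\<exists>k\<in>J. k \<le> n \<and> n \<le> k + T" if n: "n0 \<le> n" for n
  proof -
    define k where "k = Max (J \<inter> {..n})"
    have fin: "finite (J \<inter> {..n})" by simp
    have "k \<in> J \<inter> {..n}" unfolding k_def using n0 n by (intro Max_in) auto
    then have k: "k \<in> J" "k \<le> n" by auto
    have "n \<le> k + T"
    proof (rule ccontr)
      assume "\<not> n \<le> k + T"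
      then obtain t where "t > 0" "k + t \<in> J \<inter> {..n}" using next_visit[OF k(1)] by auto
      then show False using Max_ge[OF fin, of "k + t"] by (simp add: k_def)
    qed
    then show ?thesis using k by blast
  qed
  \<comment> \<open>After \<open>n0\<close> the orbit is always at most \<open>T\<close> steps past
    a visit to \<open>cball y s\<close>, so finitely many images of this ball and an initial segment
    contain it.\<close>
  define L where "L = a ` {..n0} \<union> (\<Union>t\<in>{..T}. (f ^^ t) ` cball y s)"
  have "compact ((f ^^ t) ` cball y s)" for t
    using continuous_on_subset[OF continuous_on_iterate s(2)] by (intro compact_continuous_image) auto
  then have "compact L"
    unfolding L_def by (auto intro!: compact_Un compact_UN finite_imp_compact[of "_ ` {..n0}"])
  moreover have "L \<subseteq> \<Omega>" unfolding L_def using a s iterate_in by auto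
  moreover have "a n \<in> L" for n
  proof (cases "n0 \<le> n")
    case True
    then obtain k where k: "k \<in> J" "k \<le> n" "n \<le> k + T" using last_visit by blast
    then have "a n = (f ^^ (n - k)) (a k)" by (simp flip: a_add)
    moreover have "n - k \<le> T" using k by simp
    ultimately show ?thesis unfolding L_def using J_cball[OF k(1)] by blast
  qed (auto simp: L_def)
  ultimately show ?thesis
    unfolding relatively_compact_in_def a_def by blast
qed

text \<open>Tautness is applied to the discs \<open>f ^^ N k \<circ> \<phi>\<close>. Their values at
  \<open>a\<close> stay in a compact subset of \<Omega>, which excludes compact divergence; hence
  every limit of the orbit of \<open>\<phi> b\<close> is the value at \<open>b\<close> of a limit
  disc and lies in \<Omega>.\<close>

lemma relatively_compact_orbit_disc:
  assumes taut: "taut \<Omega>" and \<phi>: "holomorphic_disc \<Omega> \<phi>" and a: "a \<in> ball 0 1" and b: "b \<in> ball 0 1"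
    and rc: "relatively_compact_in \<Omega> {(f ^^ n) (\<phi> a) | n. True}"
  shows "relatively_compact_in \<Omega> {(f ^^ n) (\<phi> b) | n. True}"
proof -
  let ?S = "{(f ^^ n) (\<phi> b) | n. True}"
  obtain L where L: "compact L" "L \<subseteq> \<Omega>" "\<And>n. (f ^^ n) (\<phi> a) \<in> L"
    using rc by (auto simp: relatively_compact_in_def)
  have "closure ?S \<subseteq> \<Omega>"
  proof
    fix z assume "z \<in> closure ?S"
    then obtain w where w: "\<And>k. w k \<in> ?S" "w \<longlonglongrightarrow> z" by (auto simp: closure_sequential)
    then have "\<forall>k. \<exists>n. w k = (f ^^ n) (\<phi> b)" by blast
    then obtain N where N: "\<And>k. w k = (f ^^ N k) (\<phi> b)" by metis
    have discs: "\<forall>k. holomorphic_disc \<Omega> (f ^^ N k \<circ> \<phi>)" using holomorphic_disc_iterate[OF \<phi>] by blast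
    from taut[unfolded taut_def, THEN spec, THEN mp, OF discs] obtain s :: "nat \<Rightarrow> nat" where s: "strict_mono s"
      and alt: "(\<exists>\<psi>. holomorphic_disc \<Omega> \<psi> \<and>
               (\<forall>K. compact K \<and> K \<subseteq> ball 0 1 \<longrightarrow>
                  uniform_limit K (\<lambda>n. f ^^ N (s n) \<circ> \<phi>) \<psi> sequentially)) \<or>
            (\<forall>K L. compact K \<and> K \<subseteq> ball 0 1 \<and> compact L \<and> L \<subseteq> \<Omega> \<longrightarrow>
               (\<forall>\<^sub>F n in sequentially. (f ^^ N (s n) \<circ> \<phi>) ` K \<inter> L = {}))"
      by (elim exE conjE)
    from alt show "z \<in> \<Omega>"
    proof
      assume "\<exists>\<psi>. holomorphic_disc \<Omega> \<psi> \<and>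
               (\<forall>K. compact K \<and> K \<subseteq> ball 0 1 \<longrightarrow>
                  uniform_limit K (\<lambda>n. f ^^ N (s n) \<circ> \<phi>) \<psi> sequentially)"
      then obtain \<psi> where \<psi>: "holomorphic_disc \<Omega> \<psi>" "uniform_limit {b} (\<lambda>n. f ^^ N (s n) \<circ> \<phi>) \<psi> sequentially"
        using b by (elim exE conjE) (drule spec[of _ "{b}"], auto)
      have "(\<lambda>n. w (s n)) \<longlonglongrightarrow> \<psi> b"
        using tendsto_uniform_limitI[OF \<psi>(2)] by (simp add: N)
      moreover have "(\<lambda>n. w (s n)) \<longlonglongrightarrow> z"
        using LIMSEQ_subseq_LIMSEQ[OF w(2) s] by (simp add: o_def)
      ultimately have "z = \<psi> b" using LIMSEQ_unique by blast
      then show ?thesis using holomorphic_discD[OF \<psi>(1) b] by simp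
    next
      assume "\<forall>K L. compact K \<and> K \<subseteq> ball 0 1 \<and> compact L \<and> L \<subseteq> \<Omega> \<longrightarrow>
               (\<forall>\<^sub>F n in sequentially. (f ^^ N (s n) \<circ> \<phi>) ` K \<inter> L = {})"
      from this[rule_format, of "{a}" L] a L have "\<forall>\<^sub>F n in sequentially. False" by simp
      then show ?thesis by simp
    qed
  qed
  moreover have "bounded ?S"
    using bounded_set by (rule bounded_subset) (use iterate_in holomorphic_discD[OF \<phi> b] in auto)
  then have "compact (closure ?S)" by simp
  ultimately show ?thesis
    unfolding relatively_compact_in_def by (intro exI[of _ "closure ?S"] conjI closure_subset)
qed

lemma relatively_compact_orbit_all:
  assumes taut: "taut \<Omega>" and x: "x \<in> \<Omega>" and y: "y \<in> \<Omega>"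
    and rc: "relatively_compact_in \<Omega> {(f ^^ n) x | n. True}"
  shows "relatively_compact_in \<Omega> {(f ^^ n) y | n. True}"
proof -
  obtain L where "disc_chain \<Omega> x y L" using disc_chain_exists[OF x y] by blast
  then show ?thesis using rc
  proof induction
    case (step x y L \<phi> a b z)
    then show ?case using relatively_compact_orbit_disc[OF taut step.hyps(2-4)] by simp
  qed
qed

end

section \<open>Orbits that escape to the boundary\<close>

locale goldilocks_escape = goldilocks_map +
  assumes no_cluster: "\<And>x y. \<lbrakk>x \<in> \<Omega>; y \<in> \<Omega>\<rbrakk> \<Longrightarrow> \<exists>e>0. \<forall>\<^sub>F n in sequentially. e \<le> norm ((f ^^ n) x - y)"
begin

text \<open>Nonexpansion makes the iterates equicontinuous, so avoidance of \<open>y\<close> by the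
  orbit of \<open>x\<close> persists for all pairs near \<open>(x, y)\<close>. Compactness of
  \<open>K \<times> L\<close>, with \<open>L\<close> the points at boundary distance at least
  \<open>r\<close>, makes it uniform.\<close>

lemma eventually_boundary_dist_small:
  assumes K: "compact K" "K \<subseteq> \<Omega>" and r: "r > 0"
  shows "\<forall>\<^sub>F n in sequentially. \<forall>x\<in>K. \<delta> ((f ^^ n) x) < r"
proof -
  obtain c where c: "c > 0" "\<And>u v. u \<in> \<Omega> \<Longrightarrow> v \<in> \<Omega> \<Longrightarrow> c * norm (u - v) \<le> d u v"
    by (rule norm_le_kobayashi_dist) blast
  define L where "L = {x \<in> \<Omega>. r \<le> \<delta> x}"
  have "\<forall>\<^sub>F n in sequentially. \<forall>p\<in>K \<times> L. (f ^^ n) (fst p) \<noteq> snd p"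
  proof (rule eventually_ball_compact)
    show "compact (K \<times> L)" unfolding L_def using K compact_boundary_dist_ge[OF r] by (intro compact_Times)
    fix p assume "p \<in> K \<times> L"
    then obtain x y where p: "p = (x, y)" and x: "x \<in> \<Omega>" and y: "y \<in> \<Omega>" using K by (auto simp: L_def)
    obtain e where e: "e > 0" and ev: "\<forall>\<^sub>F n in sequentially. e \<le> norm ((f ^^ n) x - y)"
      using no_cluster[OF x y] by blast
    obtain s where s: "s > 0" "ball x s \<subseteq> \<Omega>" "\<And>u. u \<in> ball x s \<Longrightarrow> d x u < c * (e / 2)"
      using kobayashi_dist_small[OF x, of "c * (e / 2)"] c e by auto
    have "\<forall>\<^sub>F n in sequentially. \<forall>q\<in>(ball x s \<times> ball y (e / 2)) \<inter> (K \<times> L). (f ^^ n) (fst q) \<noteq> snd q"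
      using ev
    proof eventually_elim
      case (elim n)
      show ?case
      proof (intro ballI notI)
        fix q assume q: "q \<in> (ball x s \<times> ball y (e / 2)) \<inter> (K \<times> L)" and eq: "(f ^^ n) (fst q) = snd q"
        define u where "u = fst q"
        have u: "dist x u < s" and v: "dist y ((f ^^ n) u) < e / 2" using q eq by (auto simp: u_def)
        have u': "u \<in> \<Omega>" using s(2) u by auto
        have "c * norm ((f ^^ n) x - (f ^^ n) u) \<le> d x u"
          using c(2)[OF iterate_in[OF x] iterate_in[OF u'], of n n] iterate_nonexpanding[OF x u', of n] by linarith
        also have "\<dots> < c * (e / 2)" using s(3) u by simp
        finally have "norm ((f ^^ n) x - (f ^^ n) u) < e / 2" using c(1) by (simp only: mult_less_cancel_left_pos)
        moreover have "norm ((f ^^ n) x - y) \<le> norm ((f ^^ n) x - (f ^^ n) u) + dist y ((f ^^ n) u)"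
          using dist_triangle[of "(f ^^ n) x" y "(f ^^ n) u"] by (simp add: dist_norm norm_minus_commute)
        ultimately show False using elim v by linarith
      qed
    qed
    then show "\<exists>U. open U \<and> p \<in> U \<and> (\<forall>\<^sub>F n in sequentially. \<forall>q\<in>U \<inter> (K \<times> L). (f ^^ n) (fst q) \<noteq> snd q)"
      using p s(1) e by (intro exI[of _ "ball x s \<times> ball y (e / 2)"]) (auto intro: open_Times)
  qed
  then show ?thesis
  proof eventually_elim
    case (elim n)
    show ?case
    proof
      fix x assume "x \<in> K"
      then have "(f ^^ n) x \<notin> L" using elim by force
      then show "\<delta> ((f ^^ n) x) < r" using iterate_in \<open>x \<in> K\<close> K by (auto simp: L_def)
    qed
  qed
qed

text \<open>Near the boundary the Kobayashi metric is large, so that the images of a fixed disc shrink.\<close>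

lemma locally_contracted:
  assumes x: "x \<in> \<Omega>"
  obtains r where "r > 0" "ball x r \<subseteq> \<Omega>"
    "\<And>e. e > 0 \<Longrightarrow> \<forall>\<^sub>F n in sequentially. \<forall>y\<in>ball x r. norm ((f ^^ n) y - (f ^^ n) x) < e"
proof -
  obtain s where s: "s > 0" "ball x s \<subseteq> \<Omega>" using x open_domain open_contains_ball by blast
  define r where "r = s / 2"
  have r: "r > 0" "cball x r \<subseteq> \<Omega>" using s by (auto simp: r_def)
  \<comment> \<open>The disc used below has direction \<open>2 *s (y - x)\<close> and passes through
    \<open>y\<close> at the parameter 1/2, hence \<open>T\<close>; up to that time it stays in
    \<open>cball x r\<close>.\<close>
  define T :: real where "T = artanh (1/2)"
  have tT: "tanh T = 1/2" unfolding T_def by (rule tanh_artanh) simp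
  then have T: "T > 0" by (metis half_gt_zero_iff tanh_real_pos_iff zero_less_one)
  show ?thesis
  proof (rule that[OF r(1)])
    show "ball x r \<subseteq> \<Omega>" using r by force
    fix e :: real assume e: "e > 0"
    \<comment> \<open>At speed at most \<open>e / (2 * T)\<close> a path of duration
      \<open>T\<close> moves by at most \<open>e / 2\<close>.\<close>
    obtain \<rho> where \<rho>: "\<rho> > 0" "m \<rho> < e / (2 * T)" using m_small[of "e / (2 * T)"] e T by auto
    show "\<forall>\<^sub>F n in sequentially. \<forall>y\<in>ball x r. norm ((f ^^ n) y - (f ^^ n) x) < e"
      using eventually_boundary_dist_small[OF compact_cball r(2) \<rho>(1)]
    proof eventually_elim
      case (elim n)
      show ?case
      proof
        fix y assume y: "y \<in> ball x r"
        define \<phi> where "\<phi> = (\<lambda>z::complex. x + z *s (2 *s (y - x)))"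
        have n\<phi>: "norm (\<phi> z - x) = cmod z * (2 * norm (y - x))" for z
          unfolding \<phi>_def add_diff_cancel_left' norm_vector_smult by simp
        have y': "2 * norm (y - x) < s" using y by (simp add: r_def dist_norm norm_minus_commute)
        have \<phi>: "holomorphic_disc \<Omega> \<phi>"
          unfolding \<phi>_def
        proof (rule holomorphic_disc_affine)
          fix z assume "cmod z < 1"
          then have "cmod z * (2 * norm (y - x)) \<le> 2 * norm (y - x)" by (intro mult_left_le_one_le) auto
          then have "\<phi> z \<in> ball x s" using n\<phi>[of z] y' by (simp add: dist_norm norm_minus_commute)
          then show "x + z *s (2 *s (y - x)) \<in> \<Omega>" using s(2) by (auto simp: \<phi>_def)
        qed
        have path: "unit_path T (\<lambda>t. (f ^^ n \<circ> \<phi>) (of_real (tanh t)))"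
          by (rule unit_path_disc[OF holomorphic_disc_iterate[OF \<phi>]]) (use T in simp)
        have "norm ((f ^^ n \<circ> \<phi>) (of_real (tanh T)) - (f ^^ n \<circ> \<phi>) (of_real (tanh 0))) \<le> e / (2 * T) * (T - 0)"
        proof (rule unit_pathD(4)[OF path])
          fix u assume u: "0 \<le> u" "u \<le> T"
          then have "0 \<le> tanh u" "tanh u \<le> 1/2" using tT by (auto simp flip: tT)
          then have "cmod (of_real (tanh u)) * (2 * norm (y - x)) \<le> 1/2 * (2 * norm (y - x))"
            by (intro mult_right_mono) auto
          then have "\<phi> (of_real (tanh u)) \<in> cball x r"
            using n\<phi>[of "of_real (tanh u)"] y' by (simp add: dist_norm norm_minus_commute r_def)
          then have "\<delta> ((f ^^ n) (\<phi> (of_real (tanh u)))) < \<rho>" using elim by blast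
          then have "m (\<delta> ((f ^^ n) (\<phi> (of_real (tanh u))))) \<le> m \<rho>" by (intro m_mono) simp
          then show "m (\<delta> ((f ^^ n \<circ> \<phi>) (of_real (tanh u)))) \<le> e / (2 * T)" using \<rho>(2) by simp
        qed (use T in auto)
        also have "\<dots> < e" using T e by simp
        also have "(f ^^ n \<circ> \<phi>) (of_real (tanh T)) = (f ^^ n) y"
          unfolding tT by (simp add: \<phi>_def vec_eq_iff)
        also have "(f ^^ n \<circ> \<phi>) (of_real (tanh 0)) = (f ^^ n) x" by (simp add: \<phi>_def)
        finally show "norm ((f ^^ n) y - (f ^^ n) x) < e" .
      qed
    qed
  qed
qed

text \<open>Merging is an equivalence relation between starting points, and
  \<open>locally_contracted\<close> makes its classes open.\<close>

lemma iterates_merge: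
  assumes "x \<in> \<Omega>" "y \<in> \<Omega>"
  shows "(\<lambda>n. (f ^^ n) y - (f ^^ n) x) \<longlonglongrightarrow> 0"
proof (rule connected_equivalence_relation[OF connected_domain assms])
  show "(\<lambda>n. (f ^^ n) x - (f ^^ n) y) \<longlonglongrightarrow> 0" if "(\<lambda>n. (f ^^ n) y - (f ^^ n) x) \<longlonglongrightarrow> 0" for x y
    using tendsto_minus[OF that] by simp
  show "(\<lambda>n. (f ^^ n) z - (f ^^ n) x) \<longlonglongrightarrow> 0"
    if "(\<lambda>n. (f ^^ n) y - (f ^^ n) x) \<longlonglongrightarrow> 0" "(\<lambda>n. (f ^^ n) z - (f ^^ n) y) \<longlonglongrightarrow> 0" for x y z
    using tendsto_add[OF that] by simp
  fix a assume a: "a \<in> \<Omega>"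
  obtain r where r: "r > 0" "ball a r \<subseteq> \<Omega>"
    "\<And>e. e > 0 \<Longrightarrow> \<forall>\<^sub>F n in sequentially. \<forall>y\<in>ball a r. norm ((f ^^ n) y - (f ^^ n) a) < e"
    using locally_contracted[OF a] by blast
  have "(\<lambda>n. (f ^^ n) y - (f ^^ n) a) \<longlonglongrightarrow> 0" if "y \<in> ball a r" for y
    unfolding tendsto_iff
  proof (intro allI impI)
    fix e :: real assume "e > 0"
    from r(3)[OF this] show "\<forall>\<^sub>F n in sequentially. dist ((f ^^ n) y - (f ^^ n) a) 0 < e"
      by eventually_elim (use that in simp)
  qed
  then show "\<exists>T. openin (top_of_set \<Omega>) T \<and> a \<in> T \<and> (\<forall>x\<in>T. (\<lambda>n. (f ^^ n) x - (f ^^ n) a) \<longlonglongrightarrow> 0)"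
    using a r(1) by (intro exI[of _ "\<Omega> \<inter> ball a r"]) (auto intro: openin_open_Int)
qed

lemma iterates_merge_uniformly:
  assumes x: "x \<in> \<Omega>" and K: "compact K" "K \<subseteq> \<Omega>" and e: "e > 0"
  shows "\<forall>\<^sub>F n in sequentially. \<forall>y\<in>K. norm ((f ^^ n) y - (f ^^ n) x) < e"
proof (rule eventually_ball_compact[OF K(1)])
  fix z assume "z \<in> K"
  then have z: "z \<in> \<Omega>" using K by blast
  obtain r where r: "r > 0"
    "\<And>e. e > 0 \<Longrightarrow> \<forall>\<^sub>F n in sequentially. \<forall>y\<in>ball z r. norm ((f ^^ n) y - (f ^^ n) z) < e"
    by (rule locally_contracted[OF z]) blast
  have "\<forall>\<^sub>F n in sequentially. dist ((f ^^ n) z - (f ^^ n) x) 0 < e / 2"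
    using iterates_merge[OF x z] e by (simp only: tendsto_iff half_gt_zero)
  moreover have "\<forall>\<^sub>F n in sequentially. \<forall>y\<in>ball z r. norm ((f ^^ n) y - (f ^^ n) z) < e / 2"
    using e by (intro r(2)) simp
  ultimately have "\<forall>\<^sub>F n in sequentially. \<forall>y\<in>ball z r \<inter> K. norm ((f ^^ n) y - (f ^^ n) x) < e"
  proof eventually_elim
    case (elim n)
    show ?case
    proof
      fix y assume "y \<in> ball z r \<inter> K"
      then have "norm ((f ^^ n) y - (f ^^ n) z) < e / 2" using elim by blast
      then show "norm ((f ^^ n) y - (f ^^ n) x) < e"
        using elim(1) norm_triangle_ineq[of "(f ^^ n) y - (f ^^ n) z" "(f ^^ n) z - (f ^^ n) x"] by simp
    qed
  qed
  then show "\<exists>U. open U \<and> z \<in> U \<and> (\<forall>\<^sub>F n in sequentially. \<forall>y\<in>U \<inter> K. norm ((f ^^ n) y - (f ^^ n) x) < e)"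
    using r(1) by (intro exI[of _ "ball z r"]) auto
qed

section \<open>Cluster points on the boundary\<close>

definition cluster_point :: "complex^'a \<Rightarrow> complex^'a \<Rightarrow> bool" where
  "cluster_point x \<xi> \<longleftrightarrow> (\<forall>e>0. \<exists>\<^sub>F n in sequentially. norm ((f ^^ n) x - \<xi>) < e)"

lemma cluster_pointD:
  "\<lbrakk>cluster_point x \<xi>; e > 0\<rbrakk> \<Longrightarrow> \<exists>\<^sub>F n in sequentially. norm ((f ^^ n) x - \<xi>) < e"
  by (simp add: cluster_point_def)

text \<open>Compactness of the closure gives the point and \<open>no_cluster\<close> places it on
  the frontier. The predicate \<open>P\<close> selects a subsequence of times, such as those at
  which the orbit avoids a given neighbourhood.\<close>

lemma cluster_point_exists:
  assumes x: "x \<in> \<Omega>" and P: "\<exists>\<^sub>F n in sequentially. P n"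
  obtains \<xi> where "\<xi> \<in> frontier \<Omega>" "\<And>e. e > 0 \<Longrightarrow> \<exists>\<^sub>F n in sequentially. P n \<and> norm ((f ^^ n) x - \<xi>) < e"
proof -
  have "\<exists>\<xi>\<in>closure \<Omega>. \<forall>e>0. \<exists>\<^sub>F n in sequentially. P n \<and> norm ((f ^^ n) x - \<xi>) < e"
  proof (rule ccontr)
    assume "\<not> ?thesis"
    then have neg: "\<exists>e>0. \<forall>\<^sub>F n in sequentially. \<not> (P n \<and> norm ((f ^^ n) x - \<xi>) < e)" if "\<xi> \<in> closure \<Omega>" for \<xi>
      using that by (auto simp: not_frequently)
    have "\<forall>\<^sub>F n in sequentially. \<forall>u\<in>closure \<Omega>. \<not> (P n \<and> (f ^^ n) x = u)"
    proof (rule eventually_ball_compact)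
      show "compact (closure \<Omega>)" using bounded_set by simp
      fix \<xi> assume "\<xi> \<in> closure \<Omega>"
      then obtain e where e: "e > 0" "\<forall>\<^sub>F n in sequentially. \<not> (P n \<and> norm ((f ^^ n) x - \<xi>) < e)"
        using neg by blast
      have "\<forall>\<^sub>F n in sequentially. \<forall>u\<in>ball \<xi> e \<inter> closure \<Omega>. \<not> (P n \<and> (f ^^ n) x = u)"
        using e(2) by eventually_elim (auto simp: dist_norm norm_minus_commute)
      then show "\<exists>U. open U \<and> \<xi> \<in> U \<and> (\<forall>\<^sub>F n in sequentially. \<forall>u\<in>U \<inter> closure \<Omega>. \<not> (P n \<and> (f ^^ n) x = u))"
        using e(1) by (intro exI[of _ "ball \<xi> e"]) auto
    qed
    then have "\<forall>\<^sub>F n in sequentially. \<not> P n"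
      by eventually_elim (use iterate_in[OF x] closure_subset in blast)
    then show False using P by (simp add: frequently_def)
  qed
  then obtain \<xi> where \<xi>: "\<xi> \<in> closure \<Omega>" "\<And>e. e > 0 \<Longrightarrow> \<exists>\<^sub>F n in sequentially. P n \<and> norm ((f ^^ n) x - \<xi>) < e"
    by blast
  have "\<xi> \<notin> \<Omega>"
  proof
    assume "\<xi> \<in> \<Omega>"
    then obtain e where e: "e > 0" "\<forall>\<^sub>F n in sequentially. e \<le> norm ((f ^^ n) x - \<xi>)"
      using no_cluster[OF x] by blast
    have "\<exists>\<^sub>F n in sequentially. False"
      using frequently_eventually_conj[OF \<xi>(2)[OF e(1)] e(2)] by (rule frequently_elim1) auto
    then show False by simp
  qed
  then have "\<xi> \<in> frontier \<Omega>" using \<xi>(1) open_domain by (simp add: frontier_def interior_open)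
  then show ?thesis using \<xi>(2) that by blast
qed

text \<open>If the orbit of \<open>x\<close> came back near \<open>\<xi>\<close> within bounded distance of \<open>x\<close>, then applying repeatedly
  an iterate that pushes the visibility compact towards \<open>\<eta>\<close>, while the orbit stays near \<open>\<xi>\<close>, would
  each time lower the distance from the orbit to that compact by a fixed amount.\<close>

lemma far_near_cluster_point:
  assumes x: "x \<in> \<Omega>" and ne: "\<xi> \<noteq> \<eta>" and \<xi>: "cluster_point x \<xi>" and \<eta>: "cluster_point x \<eta>"
  obtains e where "e > 0" "\<And>B. \<forall>\<^sub>F n in sequentially. norm ((f ^^ n) x - \<xi>) < e \<longrightarrow> B < d ((f ^^ n) x) x"
proof -
  define s where "s = norm (\<xi> - \<eta>)"
  have s: "s > 0" using ne by (simp add: s_def)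
  have sep: "s / 2 \<le> norm (u - v)" if "norm (u - \<xi>) \<le> s / 4" "norm (v - \<eta>) \<le> s / 4" for u v
  proof -
    have "s \<le> norm (u - \<xi>) + norm (u - v) + norm (v - \<eta>)"
      using norm_triangle_ineq4[of "u - v + (v - \<eta>)" "u - \<xi>"] norm_triangle_ineq[of "u - v" "v - \<eta>"]
      by (simp add: s_def)
    then show ?thesis using that by simp
  qed
  obtain c where c: "c > 0" "\<And>u v. u \<in> \<Omega> \<Longrightarrow> v \<in> \<Omega> \<Longrightarrow> c * norm (u - v) \<le> d u v"
    by (rule norm_le_kobayashi_dist) blast
  obtain r where r: "r > 0" and visible:
    "\<And>x y \<kappa>. \<lbrakk>x \<in> \<Omega>; y \<in> \<Omega>; s / 2 \<le> norm (x - y); 0 < \<kappa>; \<kappa> \<le> 1\<rbrakk>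
       \<Longrightarrow> \<exists>z\<in>\<Omega>. r \<le> \<delta> z \<and> d x z + d z y \<le> d x y + \<kappa>"
    using visibility[of "s/2"] s by (metis half_gt_zero)
  define K where "K = {z \<in> \<Omega>. r \<le> \<delta> z}"
  have K: "compact K" "K \<subseteq> \<Omega>" unfolding K_def using compact_boundary_dist_ge[OF r] by auto
  \<comment> \<open>A point of \<open>K\<close> and a point at boundary distance at most
    \<open>r / 2\<close> are at Kobayashi distance at least \<open>c * r / 2 = 2 * h\<close>;
    visibility loses at most \<open>h\<close> of this, leaving the gain \<open>h\<close> per
    step.\<close>
  define h where "h = c * r / 4"
  have h: "h > 0" using c r by (simp add: h_def)
  have drop: "\<exists>z\<in>K. d u z \<le> d u v - h"
    if u: "u \<in> \<Omega>" "norm (u - \<xi>) \<le> s / 4" and v: "v \<in> \<Omega>" "norm (v - \<eta>) \<le> s / 4" "\<delta> v \<le> r / 2" for u v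
  proof -
    obtain z where z: "z \<in> \<Omega>" "r \<le> \<delta> z" "d u z + d z v \<le> d u v + min 1 h"
      using visible[of u v "min 1 h"] u v sep h by auto
    have "r / 2 \<le> norm (z - v)" using boundary_dist_le[of z v] z(2) v(3) by simp
    then have "c * (r / 2) \<le> c * norm (z - v)" using c(1) by (intro mult_left_mono) auto
    also have "\<dots> \<le> d z v" using c(2) z v by blast
    finally have "2 * h \<le> d z v" by (simp add: h_def)
    then show ?thesis using z by (intro bexI[of _ z]) (auto simp: K_def)
  qed
  have "\<forall>\<^sub>F n in sequentially. (\<forall>y\<in>K. norm ((f ^^ n) y - (f ^^ n) x) < s / 8)
      \<and> (\<forall>y\<in>K. \<delta> ((f ^^ n) y) < r / 2) \<and> (\<forall>y\<in>{x}. \<delta> ((f ^^ n) y) < r / 2)"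
    using x s r K by (intro eventually_conj iterates_merge_uniformly eventually_boundary_dist_small) auto
  moreover have "\<exists>\<^sub>F n in sequentially. norm ((f ^^ n) x - \<eta>) < s / 8"
    by (rule cluster_pointD[OF \<eta>]) (use s in simp)
  ultimately have "\<exists>n. ((\<forall>y\<in>K. norm ((f ^^ n) y - (f ^^ n) x) < s / 8)
      \<and> (\<forall>y\<in>K. \<delta> ((f ^^ n) y) < r / 2) \<and> (\<forall>y\<in>{x}. \<delta> ((f ^^ n) y) < r / 2)) \<and> norm ((f ^^ n) x - \<eta>) < s / 8"
    by (intro frequently_ex[OF frequently_eventually_conj])
  \<comment> \<open>This iterate moves all of \<open>K\<close> close to both \<eta> and the
    boundary, so that \<open>drop\<close> applies with the image of any point of \<open>K\<close> as
    \<open>v\<close>.\<close>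
  then obtain n where n: "norm ((f ^^ n) x - \<eta>) < s / 8" "\<And>y. y \<in> K \<Longrightarrow> norm ((f ^^ n) y - (f ^^ n) x) < s / 8"
    "\<And>y. y \<in> K \<Longrightarrow> \<delta> ((f ^^ n) y) < r / 2" "\<delta> ((f ^^ n) x) < r / 2"
    by blast
  have pushed: "norm ((f ^^ n) y - \<eta>) \<le> s / 4" if "y \<in> K" for y
    using n(1) n(2)[OF that] norm_triangle_ineq[of "(f ^^ n) y - (f ^^ n) x" "(f ^^ n) x - \<eta>"] by simp
  have "\<exists>n. norm ((f ^^ n) x - \<xi>) < s / 8"
    by (rule frequently_ex[OF cluster_pointD[OF \<xi>]]) (use s in simp)
  then obtain k where k: "norm ((f ^^ k) x - \<xi>) < s / 8" by blast
  \<comment> \<open>One use of \<open>drop\<close> shows that \<open>K\<close> is nonempty;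
    \<open>z0\<close> starts the descent.\<close>
  obtain z0 where z0: "z0 \<in> K"
    using drop[of "(f ^^ k) x" "(f ^^ n) x"] iterate_in[OF x] k n s by force
  have descent: "\<exists>z\<in>K. d ((f ^^ (n * j)) u) z \<le> b - real j * h"
    if u: "u \<in> \<Omega>" "d u z0 \<le> b" "\<And>i. i \<le> j \<Longrightarrow> norm ((f ^^ (n * i)) u - \<xi>) \<le> s / 4" for u b j
    using u(3)
  proof (induction j)
    case 0
    then show ?case using z0 u by auto
  next
    case (Suc j)
    then obtain z where z: "z \<in> K" "d ((f ^^ (n * j)) u) z \<le> b - real j * h" by auto
    have z': "z \<in> \<Omega>" using z K by blast
    define w where "w = (f ^^ (n * j)) u"
    have w: "w \<in> \<Omega>" using iterate_in u by (simp add: w_def)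
    have eq: "(f ^^ (n * Suc j)) u = (f ^^ n) w" by (simp add: w_def funpow_add)
    have "norm ((f ^^ n) w - \<xi>) \<le> s / 4" using Suc.prems[of "Suc j"] by (simp only: eq)
    then obtain z1 where z1: "z1 \<in> K" "d ((f ^^ n) w) z1 \<le> d ((f ^^ n) w) ((f ^^ n) z) - h"
      using drop[OF iterate_in[OF w] _ iterate_in[OF z'] pushed[OF z(1)]] n(3)[OF z(1)] by force
    have "d ((f ^^ n) w) z1 \<le> b - real (Suc j) * h"
      using z1(2) z(2) iterate_nonexpanding[OF w z', of n] by (simp add: w_def algebra_simps)
    then show ?case using z1(1) eq by auto
  qed
  show ?thesis
  proof (rule that[of "s / 8"])
    show "s / 8 > 0" using s by simp
    fix B
    \<comment> \<open>After this many steps the descent would push a distance below 0.\<close>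
    obtain j :: nat where j: "B + d x z0 < real j * h" using reals_Archimedean3[OF h] by blast
    have "\<forall>\<^sub>F k in sequentially. \<forall>i\<in>{..j}. dist ((f ^^ k) ((f ^^ (n * i)) x) - (f ^^ k) x) 0 < s / 8"
      using iterates_merge[OF x iterate_in[OF x]] s
      by (intro eventually_ball_finite ballI tendstoD) auto
    then show "\<forall>\<^sub>F k in sequentially. norm ((f ^^ k) x - \<xi>) < s / 8 \<longrightarrow> B < d ((f ^^ k) x) x"
    proof eventually_elim
      case (elim k)
      show ?case
      proof (rule impI, rule ccontr)
        assume k: "norm ((f ^^ k) x - \<xi>) < s / 8" and "\<not> B < d ((f ^^ k) x) x"
        then have B: "d ((f ^^ k) x) x \<le> B" by simp
        have z0': "z0 \<in> \<Omega>" using z0 K by blast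
        have "d ((f ^^ k) x) z0 \<le> B + d x z0"
          using kobayashi_dist_triangle[OF iterate_in[OF x, of k] x z0'] B by linarith
        \<comment> \<open>The points visited by the descent remain near \<xi> because iterates
          commute: they are \<open>f ^^ k\<close> applied to finitely many fixed points, whose
          orbits merge with that of \<open>x\<close>.\<close>
        moreover have "norm ((f ^^ (n * i)) ((f ^^ k) x) - \<xi>) \<le> s / 4" if "i \<le> j" for i
        proof -
          have "(f ^^ (n * i)) ((f ^^ k) x) = (f ^^ k) ((f ^^ (n * i)) x)"
            by (metis add.commute comp_apply funpow_add)
          moreover have "norm ((f ^^ k) ((f ^^ (n * i)) x) - (f ^^ k) x) < s / 8" using elim that by simp
          ultimately show ?thesis
            using k norm_triangle_ineq[of "(f ^^ k) ((f ^^ (n * i)) x) - (f ^^ k) x" "(f ^^ k) x - \<xi>"] by simp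
        qed
        ultimately obtain z where z: "z \<in> K" "d ((f ^^ (n * j)) ((f ^^ k) x)) z \<le> B + d x z0 - real j * h"
          using descent[OF iterate_in[OF x, of k]] by blast
        moreover have "0 \<le> d ((f ^^ (n * j)) ((f ^^ k) x)) z"
          using z(1) K iterate_in x by (intro kobayashi_dist_nonneg) auto
        ultimately show False using j by linarith
      qed
    qed
  qed
qed

text \<open>At a time \<open>p\<close> where the distance to the starting point is a record,
  \<open>d (f\<^sup>p x) (f\<^sup>q x) \<le> d (f\<^bsup>p - q\<^esup> x) x \<le> d (f\<^sup>p x) x\<close>, which is incompatible with visibility if
  \<open>f\<^sup>p x\<close> and \<open>f\<^sup>q x\<close> are far apart and \<open>f\<^sup>q x\<close> is far from \<open>x\<close> in the Kobayashi distance.\<close>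

lemma cluster_point_unique:
  assumes x: "x \<in> \<Omega>" and \<xi>: "cluster_point x \<xi>" and \<eta>: "cluster_point x \<eta>"
  shows "\<xi> = \<eta>"
proof (rule ccontr)
  assume ne: "\<xi> \<noteq> \<eta>"
  define s where "s = norm (\<xi> - \<eta>)"
  have s: "s > 0" using ne by (simp add: s_def)
  define D where "D n = d ((f ^^ n) x) x" for n
  \<comment> \<open>The separation is \<open>s / 4\<close> because the final triangle inequality
    from \<xi> to \<eta> has four terms.\<close>
  obtain r where r: "r > 0" and visible:
    "\<And>x y \<kappa>. \<lbrakk>x \<in> \<Omega>; y \<in> \<Omega>; s / 4 \<le> norm (x - y); 0 < \<kappa>; \<kappa> \<le> 1\<rbrakk>
       \<Longrightarrow> \<exists>z\<in>\<Omega>. r \<le> \<delta> z \<and> d x z + d z y \<le> d x y + \<kappa>"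
    using visibility[of "s/4"] s by (metis divide_pos_pos zero_less_numeral)
  \<comment> \<open>By the growth condition the visibility compact has finite Kobayashi radius about
    \<open>x\<close>.\<close>
  obtain b where b: "\<And>z. z \<in> \<Omega> \<Longrightarrow> r \<le> \<delta> z \<Longrightarrow> d x z \<le> b"
  proof -
    obtain C \<alpha> where "\<alpha> > 0" and growth: "\<And>z. z \<in> \<Omega> \<Longrightarrow> d x z \<le> C + \<alpha> * ln (1 / \<delta> z)"
      using goldilocks x unfolding goldilocks_domain_def by meson
    have "d x z \<le> C + \<alpha> * ln (1 / r)" if z: "z \<in> \<Omega>" "r \<le> \<delta> z" for z
    proof -
      have "0 < \<delta> z" using z r by linarith
      then have "ln (1 / \<delta> z) \<le> ln (1 / r)" using z r by (subst ln_le_cancel_iff) (auto simp: field_simps)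
      then have "\<alpha> * ln (1 / \<delta> z) \<le> \<alpha> * ln (1 / r)" using \<open>\<alpha> > 0\<close> by (intro mult_left_mono) auto
      then show ?thesis using growth[OF z(1)] by linarith
    qed
    then show ?thesis by (rule that)
  qed
  obtain e where e: "e > 0" "\<And>B. \<forall>\<^sub>F n in sequentially. norm ((f ^^ n) x - \<xi>) < e \<longrightarrow> B < D n"
    using far_near_cluster_point[OF x ne \<xi> \<eta>] unfolding D_def by blast
  obtain e' where e': "e' > 0" "\<And>B. \<forall>\<^sub>F n in sequentially. norm ((f ^^ n) x - \<eta>) < e' \<longrightarrow> B < D n"
    using far_near_cluster_point[OF x ne[symmetric] \<eta> \<xi>] unfolding D_def by blast
  have late: "\<exists>q. norm ((f ^^ q) x - \<zeta>) < s / 4 \<and> B < D q"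
    if "cluster_point x \<zeta>" "e > 0" "\<And>B. \<forall>\<^sub>F n in sequentially. norm ((f ^^ n) x - \<zeta>) < e \<longrightarrow> B < D n" for \<zeta> e B
  proof -
    have "\<exists>\<^sub>F n in sequentially. norm ((f ^^ n) x - \<zeta>) < min e (s / 4)"
      using that(1,2) s by (intro cluster_pointD) auto
    from frequently_ex[OF frequently_eventually_conj[OF this that(3)]] show ?thesis by auto
  qed
  \<comment> \<open>The threshold is twice the radius \<open>b\<close> plus the visibility error 1:
    adding the triangle inequalities through \<open>z\<close> for \<open>D p\<close> and
    \<open>D k\<close> cancels \<open>D p\<close> and leaves
    \<open>D k \<le> 2 * b + 1\<close>.\<close>
  obtain q where q: "norm ((f ^^ q) x - \<xi>) < s / 4" "2 * b + 1 < D q" using late[OF \<xi> e] by blast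
  obtain q' where q': "norm ((f ^^ q') x - \<eta>) < s / 4" "2 * b + 1 < D q'" using late[OF \<eta> e'] by blast
  obtain p where p: "q \<le> p" "q' \<le> p" and highest: "\<And>n. n \<le> p \<Longrightarrow> D n \<le> D p"
  proof -
    \<comment> \<open>The first time at which \<open>D\<close> exceeds all its values up to
      \<open>max q q'\<close> is a record and comes after both \<open>q\<close> and
      \<open>q'\<close>.\<close>
    define B where "B = Max (D ` {..max q q'})"
    obtain n where n: "B < D n" using late[OF \<xi> e, of B] by blast
    define p where "p = (LEAST n. B < D n)"
    have p: "B < D p" unfolding p_def by (rule LeastI[of _ n]) (rule n)
    have below: "D k \<le> B" if "k < p" for k
      using not_less_Least[of k "\<lambda>n. B < D n"] that by (simp add: p_def not_less)
    have rec: "D k \<le> D p" if "k \<le> p" for k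
      using below[of k] p that by (cases "k = p") auto
    have "max q q' < p"
    proof (rule ccontr)
      assume "\<not> max q q' < p"
      then have "D p \<le> B" unfolding B_def by (intro Max_ge) auto
      then show False using p by simp
    qed
    then show ?thesis using rec by (intro that[of p]) auto
  qed
  have close: "norm ((f ^^ p) x - (f ^^ k) x) < s / 4" if k: "k \<le> p" "2 * b + 1 < D k" for k
  proof (rule ccontr)
    assume "\<not> ?thesis"
    then obtain z where z: "z \<in> \<Omega>" "r \<le> \<delta> z"
      "d ((f ^^ p) x) z + d z ((f ^^ k) x) \<le> d ((f ^^ p) x) ((f ^^ k) x) + 1"
      using visible[OF iterate_in[OF x, of p] iterate_in[OF x, of k], of 1] by auto
    have "d ((f ^^ p) x) ((f ^^ k) x) \<le> D (p - k)"
      using iterate_nonexpanding[OF iterate_in[OF x, of "p - k"] x, of k] k(1)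
      by (simp add: D_def flip: comp_apply[of "f ^^ k" "f ^^ (p - k)"] funpow_add)
    also have "\<dots> \<le> D p" by (rule highest) simp
    finally have "d ((f ^^ p) x) z + d z ((f ^^ k) x) \<le> D p + 1" using z(3) by simp
    moreover have "D p \<le> d ((f ^^ p) x) z + d z x"
      unfolding D_def using iterate_in x z by (intro kobayashi_dist_triangle) auto
    moreover have "D k \<le> d ((f ^^ k) x) z + d z x"
      unfolding D_def using iterate_in x z by (intro kobayashi_dist_triangle) auto
    ultimately show False
      using b[OF z(1,2)] k(2) kobayashi_dist_commute[of z] by simp
  qed
  have "s \<le> norm ((f ^^ p) x - (f ^^ q) x) + norm ((f ^^ q) x - \<xi>) + (norm ((f ^^ p) x - (f ^^ q') x) + norm ((f ^^ q') x - \<eta>))"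
    using norm_triangle_ineq4[of "(f ^^ p) x - \<eta>" "(f ^^ p) x - \<xi>"]
      norm_triangle_ineq[of "(f ^^ p) x - (f ^^ q) x" "(f ^^ q) x - \<xi>"]
      norm_triangle_ineq[of "(f ^^ p) x - (f ^^ q') x" "(f ^^ q') x - \<eta>"]
    by (simp add: s_def)
  then show False using close[OF p(1) q(2)] close[OF p(2) q'(2)] q(1) q'(1) by linarith
qed

lemma iterates_converge:
  "\<exists>\<xi>\<in>frontier \<Omega>. (\<forall>x\<in>\<Omega>. (\<lambda>n. (f ^^ n) x) \<longlonglongrightarrow> \<xi>) \<and>
     (\<forall>K. compact K \<and> K \<subseteq> \<Omega> \<longrightarrow> uniform_limit K (\<lambda>n. f ^^ n) (\<lambda>x. \<xi>) sequentially)"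
proof -
  obtain x where x: "x \<in> \<Omega>" using domain_nonempty by blast
  obtain \<xi> where \<xi>: "\<xi> \<in> frontier \<Omega>" "\<And>e. e > 0 \<Longrightarrow> \<exists>\<^sub>F n in sequentially. True \<and> norm ((f ^^ n) x - \<xi>) < e"
    by (rule cluster_point_exists[OF x, of "\<lambda>_. True"]) auto
  then have cl: "cluster_point x \<xi>" by (simp add: cluster_point_def)
  have lim: "(\<lambda>n. (f ^^ n) x) \<longlonglongrightarrow> \<xi>"
  proof (rule ccontr)
    assume "\<not> ?thesis"
    then obtain e where e: "e > 0" "\<exists>\<^sub>F n in sequentially. \<not> norm ((f ^^ n) x - \<xi>) < e"
      by (auto simp: tendsto_iff dist_norm not_eventually)
    \<comment> \<open>A cluster point along the times spent outside the
      \<open>e\<close>-neighbourhood of \<xi> cannot be \<xi>.\<close>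
    obtain \<eta> where \<eta>: "\<And>e'. e' > 0 \<Longrightarrow> \<exists>\<^sub>F n in sequentially. \<not> norm ((f ^^ n) x - \<xi>) < e \<and> norm ((f ^^ n) x - \<eta>) < e'"
      by (rule cluster_point_exists[OF x e(2)]) blast
    have "cluster_point x \<eta>"
      unfolding cluster_point_def by (blast intro: frequently_elim1[OF \<eta>])
    then have "\<xi> = \<eta>" by (rule cluster_point_unique[OF x cl])
    then have "\<exists>\<^sub>F n in sequentially. False" using \<eta>[OF e(1)] by simp
    then show False by simp
  qed
  have unif: "uniform_limit K (\<lambda>n. f ^^ n) (\<lambda>x. \<xi>) sequentially" if K: "compact K" "K \<subseteq> \<Omega>" for K
    unfolding uniform_limit_iff
  proof (intro allI impI)
    fix e :: real assume e: "e > 0"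
    have "\<forall>\<^sub>F n in sequentially. \<forall>y\<in>K. norm ((f ^^ n) y - (f ^^ n) x) < e / 2"
      using e by (intro iterates_merge_uniformly[OF x K]) simp
    moreover have "\<forall>\<^sub>F n in sequentially. dist ((f ^^ n) x) \<xi> < e / 2"
      using e by (intro tendstoD[OF lim]) simp
    ultimately show "\<forall>\<^sub>F n in sequentially. \<forall>y\<in>K. dist ((f ^^ n) y) \<xi> < e"
    proof eventually_elim
      case (elim n)
      show ?case
      proof
        fix y assume "y \<in> K"
        then have "dist ((f ^^ n) y) ((f ^^ n) x) < e / 2" using elim(1) by (simp add: dist_norm)
        then show "dist ((f ^^ n) y) \<xi> < e" using elim(2) dist_triangle[of "(f ^^ n) y" \<xi> "(f ^^ n) x"]
          by linarith
      qed
    qed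
  qed
  have "(\<lambda>n. (f ^^ n) y) \<longlonglongrightarrow> \<xi>" if "y \<in> \<Omega>" for y
    using tendsto_uniform_limitI[OF unif[of "{y}"]] that by simp
  then show ?thesis using \<xi>(1) unif by blast
qed

end

theorem theorem1p10:
  fixes \<Omega> :: "(complex^'d) set" and f :: "complex^'d \<Rightarrow> complex^'d"
  assumes "goldilocks_domain \<Omega>" and "taut \<Omega>"
    and "holomorphic_map_on f \<Omega>" and "f ` \<Omega> \<subseteq> \<Omega>"
  shows "(\<forall>x\<in>\<Omega>. relatively_compact_in \<Omega> {(f ^^ n) x | n. True}) \<or>
         (\<exists>\<xi>\<in>frontier \<Omega>. (\<forall>x\<in>\<Omega>. (\<lambda>n. (f ^^ n) x) \<longlonglongrightarrow> \<xi>) \<and>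
            (\<forall>K. compact K \<and> K \<subseteq> \<Omega> \<longrightarrow>
               uniform_limit K (\<lambda>n. f ^^ n) (\<lambda>x. \<xi>) sequentially))"
proof -
  interpret goldilocks_map \<Omega> f
    using assms by unfold_locales (auto simp: goldilocks_domain_def)
  show ?thesis
  \<comment> \<open>One interior cluster point of one orbit already makes all orbits relatively
    compact, so in the other case \<open>no_cluster\<close> holds for every orbit at once.\<close>
  proof (cases "\<exists>x\<in>\<Omega>. \<exists>y\<in>\<Omega>. \<forall>e>0. \<exists>\<^sub>F n in sequentially. norm ((f ^^ n) x - y) < e")
    case True
    then obtain x y where "x \<in> \<Omega>" "y \<in> \<Omega>" "\<And>e. e > 0 \<Longrightarrow> \<exists>\<^sub>F n in sequentially. norm ((f ^^ n) x - y) < e"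
      by blast
    then have "relatively_compact_in \<Omega> {(f ^^ n) x | n. True}"
      by (rule relatively_compact_orbit_if_cluster_point)
    then show ?thesis using relatively_compact_orbit_all[OF assms(2) \<open>x \<in> \<Omega>\<close>] by blast
  next
    case False
    interpret goldilocks_escape \<Omega> f
      using False by unfold_locales (auto simp: not_frequently not_less)
    show ?thesis using iterates_converge by (rule disjI2)
  qed
qed

end
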